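(* Let $n\ge k\ge 1$ and write $n=dk+r$ with integers $d\ge 0$ and $0\le r<k$. Then $$\sum_{\pi\in B_n}x^{\mathrm{des}_k^B(\pi)}=2^{n-d}M_{n,k}\,B_d(x)\,A_d(x)^{k-r-1}A_{d+1}(x)^{r},$$ $$\sum_{\pi\in B_n}x^{\mathrm{fdes}_k^B(\pi)}=2^{n-d}M_{n,k}\,F_d(x)\,A_d(x^2)^{k-r-1}A_{d+1}(x^2)^{r},$$ $$\sum_{\pi\in B_n}x^{\mathrm{inv}_k^B(\pi)}=2^{k-1}M_{n,k}\,[d]_x^{\,k-r-1}\,[d+1]_x^{\,r}\,\big([2d]_x!!\big)^{r+1}\big([2(d-1)]_x!!\big)^{k-r-1}.$$
   Context: $B_n$ is the set of signed permutations of $[n]$: bijections $\pi$ of $\{\pm1,\dots,\pm n\}$ with $\pi(-i)=-\pi(i)$, written $\pi=(\pi(1),\dots,\pi(n))$; set $\pi(0)=0$. For $1\le k\le n$: $\mathrm{des}_k^B(\pi)=|\{0\le i\le n-k:\pi(i)>\pi(i+k)\}|$; $\mathrm{des}_k^A(\pi)=|\{1\le i\le n-k:\pi(i)>\pi(i+k)\}|$; $\mathrm{fdes}_k^B(\pi)=\mathrm{des}_k^A(\pi)+\mathrm{des}_k^B(\pi)$; $\mathrm{inv}_k^A(\pi)=|\{(i,j):1\le i<j\le n,\ \pi(i)>\pi(j),\ j-i=mk \text{ for some } m>0\}|$; $\mathrm{neg}_k(\pi)=|\{1\le i\le\lfloor n/k\rfloor:\pi(ik)<0\}|$; $\mathrm{nsp}_k(\pi)=|\{(i,j)\in[n]^2:\pi(i)+\pi(j)<0,\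 j-i=mk\text{ for some }m>0\}|$; $\mathrm{inv}_k^B(\pi)=\mathrm{inv}_k^A(\pi)+\mathrm{neg}_k(\pi)+\mathrm{nsp}_k(\pi)$. Write $\mathrm{des}^A=\mathrm{des}_1^A$, $\mathrm{des}^B=\mathrm{des}_1^B$, $\mathrm{fdes}^B=\mathrm{fdes}_1^B$. $A_m(x)=\sum_{\sigma\in\mathfrak{S}_m}x^{\mathrm{des}^A(\sigma)}$ (ordinary Eulerian polynomial, $\mathfrak{S}_m$ the symmetric group), $B_m(x)=\sum_{\pi\in B_m}x^{\mathrm{des}^B(\pi)}$, $F_m(x)=\sum_{\pi\in B_m}x^{\mathrm{fdes}^B(\pi)}$. $M_{n,k}=\dfrac{n!}{((d+1)!)^r(d!)^{k-r}}$ (multinomial coefficient). $[m]_x=1+x+\dots+x^{m-1}$, $[2m]_x!!=\prod_{i=1}^m[2i]_x$, $[0]_x!!=1$. *)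

theory Defs
  imports "HOL-Combinatorics.Permutations" "HOL-Computational_Algebra.Polynomial"
begin

text \<open>
  A signed permutation is a function on all integers that is the identity outside
  \<open>{-n..n} - {0}\<close>; in particular the convention \<open>\<pi> 0 = 0\<close> is built in, and so is
  \<open>\<pi> (- i) = - \<pi> i\<close> outside that set.
\<close>
definition signed_perms :: "nat \<Rightarrow> (int \<Rightarrow> int) set" where
  "signed_perms n = {\<pi>. \<pi> permutes ({- int n..int n} - {0}) \<and> (\<forall>i. \<pi> (- i) = - \<pi> i)}"

definition perms :: "nat \<Rightarrow> (int \<Rightarrow> int) set" where
  "perms n = {\<sigma>. \<sigma> permutes {1..int n}}"

definition des_A :: "nat \<Rightarrow> nat \<Rightarrow> (int \<Rightarrow> int) \<Rightarrow> nat" where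
  "des_A n k \<pi> = card {i. 1 \<le> i \<and> i \<le> int n - int k \<and> \<pi> i > \<pi> (i + int k)}"

definition des_B :: "nat \<Rightarrow> nat \<Rightarrow> (int \<Rightarrow> int) \<Rightarrow> nat" where
  "des_B n k \<pi> = card {i. 0 \<le> i \<and> i \<le> int n - int k \<and> \<pi> i > \<pi> (i + int k)}"

definition fdes_B :: "nat \<Rightarrow> nat \<Rightarrow> (int \<Rightarrow> int) \<Rightarrow> nat" where
  "fdes_B n k \<pi> = des_A n k \<pi> + des_B n k \<pi>"

definition inv_A :: "nat \<Rightarrow> nat \<Rightarrow> (int \<Rightarrow> int) \<Rightarrow> nat" where
  "inv_A n k \<pi> = card {(i, j). 1 \<le> i \<and> i < j \<and> j \<le> int n \<and> \<pi> i > \<pi> j \<and>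
     (\<exists>m>0. j - i = m * int k)}"

definition neg :: "nat \<Rightarrow> nat \<Rightarrow> (int \<Rightarrow> int) \<Rightarrow> nat" where
  "neg n k \<pi> = card {i. 1 \<le> i \<and> i \<le> int (n div k) \<and> \<pi> (i * int k) < 0}"

definition nsp :: "nat \<Rightarrow> nat \<Rightarrow> (int \<Rightarrow> int) \<Rightarrow> nat" where
  "nsp n k \<pi> = card {(i, j). i \<in> {1..int n} \<and> j \<in> {1..int n} \<and> \<pi> i + \<pi> j < 0 \<and>
     (\<exists>m>0. j - i = m * int k)}"

definition inv_B :: "nat \<Rightarrow> nat \<Rightarrow> (int \<Rightarrow> int) \<Rightarrow> nat" where
  "inv_B n k \<pi> = inv_A n k \<pi> + neg n k \<pi> + nsp n k \<pi>"

text \<open>The indeterminate \<open>x\<close> is \<open>monom 1 1\<close>, so \<open>x ^ e\<close> is \<open>monom 1 e\<close>.\<close>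

definition eulerian_A :: "nat \<Rightarrow> int poly" where
  "eulerian_A m = (\<Sum>\<sigma>\<in>perms m. monom 1 (des_A m 1 \<sigma>))"

definition eulerian_B :: "nat \<Rightarrow> int poly" where
  "eulerian_B m = (\<Sum>\<pi>\<in>signed_perms m. monom 1 (des_B m 1 \<pi>))"

definition flag_eulerian_B :: "nat \<Rightarrow> int poly" where
  "flag_eulerian_B m = (\<Sum>\<pi>\<in>signed_perms m. monom 1 (fdes_B m 1 \<pi>))"

definition q_num :: "nat \<Rightarrow> int poly" where
  "q_num m = (\<Sum>i<m. monom 1 i)"

text \<open>\<open>q_even_dfact m\<close> is the double factorial of \<open>2m\<close>, i.e. \<open>[2]\<^sub>x [4]\<^sub>x \<dots> [2m]\<^sub>x\<close>.\<close>
definition q_even_dfact :: "nat \<Rightarrow> int poly" where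
  "q_even_dfact m = (\<Prod>i=1..m. q_num (2 * i))"

text \<open>The division is exact, by \<open>multinom_denominator_dvd\<close> below.\<close>
definition multinom :: "nat \<Rightarrow> nat \<Rightarrow> nat" where
  "multinom n k = fact n div (fact (n div k + 1) ^ (n mod k) * fact (n div k) ^ (k - n mod k))"

lemma fact_power_dvd_fact: "(fact a :: nat) ^ m dvd fact (m * a)"
proof (induction m)
  case (Suc m)
  have "(fact a :: nat) ^ Suc m dvd fact a * fact (m * a)"
    using Suc by (simp add: mult_dvd_mono)
  also have "\<dots> dvd fact (a + m * a)"
    by (rule fact_fact_dvd_fact)
  finally show ?case by simp
qed simp

lemma multinom_denominator_dvd:
  assumes "k \<ge> 1"
  shows "(fact (n div k + 1) ^ (n mod k) * fact (n div k) ^ (k - n mod k) :: nat) dvd fact n"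
proof -
  define d r where "d = n div k" and "r = n mod k"
  have r: "r < k" using assms by (simp add: r_def)
  then obtain s where s: "k = r + s" using less_imp_add_positive by blast
  have "n = d * k + r" by (simp add: d_def r_def)
  then have n: "n = r * (d + 1) + (k - r) * d" by (simp add: s algebra_simps)
  have "(fact (d + 1) ^ r * fact d ^ (k - r) :: nat)
      dvd fact (r * (d + 1)) * fact ((k - r) * d)"
    by (intro mult_dvd_mono fact_power_dvd_fact)
  also have "\<dots> dvd fact n"
    unfolding n by (rule fact_fact_dvd_fact)
  finally show ?thesis by (simp add: d_def r_def)
qed

end

theory Submission
  imports Defs "HOL-Library.Disjoint_Sets"
begin

text \<open>
  All three statistics compare only entries whose positions agree modulo \<open>k\<close>, so each is a sum of
  statistics of the subwords of \<open>\<pi>\<close> along the residue classes. Class \<open>0\<close> has \<open>d\<close> positions and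
  carries the type B statistic; of the other classes, \<open>r\<close> have \<open>d + 1\<close> positions and \<open>k - r - 1\<close>
  have \<open>d\<close>. The distribution of each subword statistic does not depend on which absolute
  values the subword uses, so the generating function is the multinomial number of ways to distribute
  the absolute values, times a product of one factor per class. For descents, a class other than \<open>0\<close>
  contributes \<open>2 ^ s\<close> Eulerian polynomials, one for each choice of negative values. For inversions,
  deleting the last letter of a subword gives the factor
  \<open>[s]\<^sub>x (1 + x ^ (s - 1))\<close> for the classes other than \<open>0\<close> (the type D length) and
  \<open>[s]\<^sub>x (1 + x ^ s) = [2 s]\<^sub>x\<close> for class \<open>0\<close> (the type B length).
\<close>

subsection \<open>Signed words\<close>

text \<open>Words vanish off \<open>P\<close>, so that words on disjoint position sets are combined by pointwise addition.\<close>

definition signed_words :: "'a set \<Rightarrow> int set \<Rightarrow> ('a \<Rightarrow> int) set" where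
  "signed_words P V = {f. (\<forall>i. i \<notin> P \<longrightarrow> f i = 0) \<and> bij_betw (\<lambda>i. \<bar>f i\<bar>) P V}"

lemma signed_wordsD:
  assumes "f \<in> signed_words P V"
  shows "i \<notin> P \<Longrightarrow> f i = 0" "bij_betw (\<lambda>i. \<bar>f i\<bar>) P V" "i \<in> P \<Longrightarrow> \<bar>f i\<bar> \<in> V"
  using assms by (auto simp: signed_words_def bij_betw_def)

lemma finite_signed_words:
  assumes "finite P" "finite V"
  shows "finite (signed_words P V)"
proof (rule finite_subset)
  show "signed_words P V \<subseteq> {f. \<forall>i. (i \<in> P \<longrightarrow> f i \<in> V \<union> uminus ` V) \<and> (i \<notin> P \<longrightarrow> f i = 0)}"
  proof safe
    fix f i assume f: "f \<in> signed_words P V" and "i \<in> P" and "f i \<notin> uminus ` V"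
    then show "f i \<in> V"
      using signed_wordsD(3)[OF f \<open>i \<in> P\<close>] by (auto simp: abs_if image_iff split: if_splits)
  qed (auto simp: signed_words_def)
  show "finite \<dots>"
    using assms by (intro finite_set_of_finite_funs) auto
qed

lemma signed_words_empty: "signed_words {} {} = {\<lambda>_. 0}"
  by (auto simp: signed_words_def fun_eq_iff bij_betw_def)

lemma signed_words_add:
  assumes "P \<inter> Q = {}" "U \<subseteq> V" "a \<in> signed_words P U" "b \<in> signed_words Q (V - U)"
  shows "(\<lambda>i. a i + b i) \<in> signed_words (P \<union> Q) V"
proof -
  have b0: "b i = 0" if "i \<in> P" for i
    using that assms(1) by (intro signed_wordsD(1)[OF assms(4)]) auto
  have a0: "a i = 0" if "i \<in> Q" for i
    using that assms(1) by (intro signed_wordsD(1)[OF assms(3)]) auto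
  have "bij_betw (\<lambda>i. \<bar>a i + b i\<bar>) P U"
    using signed_wordsD(2)[OF assms(3)] by (simp add: b0 cong: bij_betw_cong)
  moreover have "bij_betw (\<lambda>i. \<bar>a i + b i\<bar>) Q (V - U)"
    using signed_wordsD(2)[OF assms(4)] by (simp add: a0 cong: bij_betw_cong)
  ultimately have "bij_betw (\<lambda>i. \<bar>a i + b i\<bar>) (P \<union> Q) (U \<union> (V - U))"
    by (rule bij_betw_combine) auto
  moreover have "U \<union> (V - U) = V" using assms(2) by auto
  ultimately show ?thesis
    using signed_wordsD(1)[OF assms(3)] signed_wordsD(1)[OF assms(4)]
    by (auto simp: signed_words_def)
qed

text \<open>A word on \<open>P \<union> Q\<close> amounts to the set \<open>U\<close> of absolute
  values it uses on \<open>P\<close> together with its two restrictions, and adding the restrictions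
  recovers it because each vanishes off its own positions. The condition
  \<open>card U = card P\<close> makes the number of choices of \<open>U\<close> a binomial
  coefficient.\<close>

lemma sum_signed_words_Un:
  fixes g :: "('a \<Rightarrow> int) \<Rightarrow> 'r::comm_monoid_add"
  assumes "P \<inter> Q = {}" "finite P" "finite Q" "finite V"
  shows "(\<Sum>f\<in>signed_words (P \<union> Q) V. g f) =
    (\<Sum>U | U \<subseteq> V \<and> card U = card P.
      \<Sum>a\<in>signed_words P U. \<Sum>b\<in>signed_words Q (V - U). g (\<lambda>i. a i + b i))"
proof -
  define R where "R = (SIGMA U:{U. U \<subseteq> V \<and> card U = card P}.
    signed_words P U \<times> signed_words Q (V - U))"
  define split where "split = (\<lambda>f::'a \<Rightarrow> int. ((\<lambda>i. \<bar>f i\<bar>) ` P,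
    (\<lambda>i. if i \<in> P then f i else 0), (\<lambda>i. if i \<in> Q then f i else 0)))"
  have "(\<Sum>f\<in>signed_words (P \<union> Q) V. g f) = (\<Sum>(U, a, b)\<in>R. g (\<lambda>i. a i + b i))"
  proof (rule sum.reindex_bij_witness[where i = "\<lambda>(U, a, b) i. a i + b i" and j = split])
    fix f assume f: "f \<in> signed_words (P \<union> Q) V"
    note fD = signed_wordsD[OF f]
    show "(case split f of (U, a, b) \<Rightarrow> \<lambda>i. a i + b i) = f"
      using assms(1) fD(1) by (auto simp: split_def fun_eq_iff)
    then show "(case split f of (U, a, b) \<Rightarrow> g (\<lambda>i. a i + b i)) = g f"
      by (simp add: split_def)
    have inj: "inj_on (\<lambda>i. \<bar>f i\<bar>) (P \<union> Q)" and im: "(\<lambda>i. \<bar>f i\<bar>) ` (P \<union> Q) = V"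
      using fD(2) by (auto simp: bij_betw_def)
    have injP: "inj_on (\<lambda>i. \<bar>f i\<bar>) P" and injQ: "inj_on (\<lambda>i. \<bar>f i\<bar>) Q"
      using inj by (auto simp: inj_on_def)
    have "(\<lambda>i. \<bar>f i\<bar>) ` Q = V - (\<lambda>i. \<bar>f i\<bar>) ` P"
      using inj_on_image_Int[OF inj, of P Q] assms(1) im by auto
    then have "bij_betw (\<lambda>i. \<bar>f i\<bar>) Q (V - (\<lambda>i. \<bar>f i\<bar>) ` P)"
      using injQ by (simp add: bij_betw_def)
    then have "(\<lambda>i. if i \<in> Q then f i else 0) \<in> signed_words Q (V - (\<lambda>i. \<bar>f i\<bar>) ` P)"
      by (auto simp: signed_words_def cong: bij_betw_cong)
    moreover have "(\<lambda>i. if i \<in> P then f i else 0) \<in> signed_words P ((\<lambda>i. \<bar>f i\<bar>) ` P)"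
      using inj_on_imp_bij_betw[OF injP] by (auto simp: signed_words_def cong: bij_betw_cong)
    ultimately show "split f \<in> R"
      using im card_image[OF injP] by (auto simp: R_def split_def)
  next
    fix x assume "x \<in> R"
    then obtain U a b where x: "x = (U, a, b)" and U: "U \<subseteq> V"
      and a: "a \<in> signed_words P U" and b: "b \<in> signed_words Q (V - U)"
      by (auto simp: R_def)
    show "(case x of (U, a, b) \<Rightarrow> \<lambda>i. a i + b i) \<in> signed_words (P \<union> Q) V"
      using signed_words_add[OF assms(1) U a b] by (simp add: x)
    have b0: "b i = 0" if "i \<in> P" for i
      using that assms(1) by (intro signed_wordsD(1)[OF b]) auto
    have a0: "a i = 0" if "i \<in> Q" for i
      using that assms(1) by (intro signed_wordsD(1)[OF a]) auto
    have "(\<lambda>i. \<bar>a i + b i\<bar>) ` P = (\<lambda>i. \<bar>a i\<bar>) ` P"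
      by (intro image_cong) (simp_all add: b0)
    also have "\<dots> = U" using signed_wordsD(2)[OF a] by (simp add: bij_betw_def)
    finally show "split (case x of (U, a, b) \<Rightarrow> \<lambda>i. a i + b i) = x"
      using signed_wordsD(1)[OF a] signed_wordsD(1)[OF b] a0 b0
      by (simp add: x split_def fun_eq_iff)
  qed
  also have "\<dots> = (\<Sum>U | U \<subseteq> V \<and> card U = card P.
      \<Sum>(a, b)\<in>signed_words P U \<times> signed_words Q (V - U). g (\<lambda>i. a i + b i))"
    unfolding R_def using assms
    by (subst sum.Sigma[symmetric])
       (auto intro!: finite_cartesian_product finite_signed_words intro: finite_subset)
  also have "\<dots> = (\<Sum>U | U \<subseteq> V \<and> card U = card P.
      \<Sum>a\<in>signed_words P U. \<Sum>b\<in>signed_words Q (V - U). g (\<lambda>i. a i + b i))"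
    by (simp add: sum.cartesian_product)
  finally show ?thesis .
qed

text \<open>Induction on the classes, splitting off one at a time. Hypothesis \<open>T\<close> says
  that a class sum depends only on how many values are available, so the sum over value sets
  \<open>U\<close> merely counts them. The factorials of the class sizes multiply the left side
  instead of dividing the right, which keeps the identity inside a semiring.\<close>

lemma sum_signed_words_prod:
  fixes g :: "'c \<Rightarrow> ('a \<Rightarrow> int) \<Rightarrow> 'r::comm_semiring_1"
  assumes "finite I" "\<And>c. c \<in> I \<Longrightarrow> finite (P c)" "disjoint_family_on P I"
    and local: "\<And>c f h. c \<in> I \<Longrightarrow> (\<And>i. i \<in> P c \<Longrightarrow> f i = h i) \<Longrightarrow> g c f = g c h"
    and T: "\<And>c U. c \<in> I \<Longrightarrow> finite U \<Longrightarrow> U \<subseteq> {0<..} \<Longrightarrow> card U = card (P c) \<Longrightarrow>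
              (\<Sum>f\<in>signed_words (P c) U. g c f) = T c"
    and "finite V" "V \<subseteq> {0<..}" "card V = card (\<Union>c\<in>I. P c)"
  shows "of_nat (\<Prod>c\<in>I. fact (card (P c))) * (\<Sum>f\<in>signed_words (\<Union>c\<in>I. P c) V. \<Prod>c\<in>I. g c f) =
    of_nat (fact (card V)) * (\<Prod>c\<in>I. T c)"
  using assms
proof (induction I arbitrary: V rule: finite_induct)
  case empty
  then have "V = {}" by simp
  then show ?case by (simp add: signed_words_empty)
next
  case (insert c J)
  define Q where "Q = (\<Union>c\<in>J. P c)"
  define fJ where "fJ = (\<Prod>c\<in>J. fact (card (P c)) :: nat)"
  have disj: "P c \<inter> Q = {}" and disjJ: "disjoint_family_on P J"
    using insert.prems(2) insert.hyps by (auto simp: disjoint_family_on_insert Q_def)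
  have fin: "finite (P c)" "finite Q"
    using insert.prems(1) insert.hyps by (auto simp: Q_def)
  have cardV: "card V = card (P c) + card Q"
    using insert.prems(7) fin disj by (simp add: Q_def card_Un_disjoint)
  have gc: "g c (\<lambda>i. a i + b i) = g c a" if "b \<in> signed_words Q W" for a b W
  proof (rule insert.prems(3))
    fix i assume "i \<in> P c"
    then have "i \<notin> Q" using disj by auto
    then show "a i + b i = a i" by (simp add: signed_wordsD(1)[OF that])
  qed simp
  have gJ: "(\<Prod>c'\<in>J. g c' (\<lambda>i. a i + b i)) = (\<Prod>c'\<in>J. g c' b)" if "a \<in> signed_words (P c) W" for a b W
  proof (intro prod.cong refl insert.prems(3))
    fix c' i assume "c' \<in> J" "i \<in> P c'"
    then have "i \<notin> P c" using disj by (auto simp: Q_def)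
    then show "a i + b i = b i" by (simp add: signed_wordsD(1)[OF that])
  qed auto
  \<comment> \<open>\<open>V - U\<close> is again a set of positive values of the size required by
    the remaining classes, so the induction hypothesis gives the same result for every
    \<open>U\<close>.\<close>
  have rest: "of_nat fJ * (\<Sum>b\<in>signed_words Q (V - U). \<Prod>c\<in>J. g c b) =
      of_nat (fact (card Q)) * (\<Prod>c\<in>J. T c)" if "U \<subseteq> V" "card U = card (P c)" for U
  proof -
    have card: "card (V - U) = card Q"
      using that cardV insert.prems(5) by (simp add: card_Diff_subset finite_subset)
    have "of_nat fJ * (\<Sum>b\<in>signed_words Q (V - U). \<Prod>c\<in>J. g c b) =
        of_nat (fact (card (V - U))) * (\<Prod>c\<in>J. T c)"
      unfolding fJ_def Q_def
    proof (rule insert.IH)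
      show "card (V - U) = card (\<Union>c\<in>J. P c)" using card by (simp add: Q_def)
      show "finite (V - U)" "V - U \<subseteq> {0<..}" using insert.prems(5,6) by auto
    qed (use insert.prems(1-4) disjJ in blast)+
    then show ?thesis by (simp only: card)
  qed
  have "(\<Sum>f\<in>signed_words (P c \<union> Q) V. g c f * (\<Prod>c\<in>J. g c f)) =
    (\<Sum>U | U \<subseteq> V \<and> card U = card (P c).
      \<Sum>a\<in>signed_words (P c) U. \<Sum>b\<in>signed_words Q (V - U). g c a * (\<Prod>c\<in>J. g c b))"
    unfolding sum_signed_words_Un[OF disj fin insert.prems(5)]
    by (intro sum.cong refl) (simp add: gc gJ)
  also have "of_nat fJ * \<dots> = (\<Sum>U | U \<subseteq> V \<and> card U = card (P c).
      (\<Sum>a\<in>signed_words (P c) U. g c a) * (of_nat fJ * (\<Sum>b\<in>signed_words Q (V - U). \<Prod>c\<in>J. g c b)))"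
    by (simp only: sum_distrib_left mult.left_commute[of "of_nat fJ"] flip: sum_product)
  also have "\<dots> = (\<Sum>U | U \<subseteq> V \<and> card U = card (P c).
      T c * (of_nat (fact (card Q)) * (\<Prod>c\<in>J. T c)))"
  proof (intro sum.cong refl)
    fix U assume "U \<in> {U. U \<subseteq> V \<and> card U = card (P c)}"
    then have U: "U \<subseteq> V" "card U = card (P c)" by auto
    have "(\<Sum>a\<in>signed_words (P c) U. g c a) = T c"
      using U insert.prems(5,6) by (intro insert.prems(4)) (auto intro: finite_subset)
    with rest[OF U] show "(\<Sum>a\<in>signed_words (P c) U. g c a) *
        (of_nat fJ * (\<Sum>b\<in>signed_words Q (V - U). \<Prod>c\<in>J. g c b)) =
        T c * (of_nat (fact (card Q)) * (\<Prod>c\<in>J. T c))" by simp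
  qed
  also have "\<dots> = of_nat (card V choose card (P c)) * (T c * (of_nat (fact (card Q)) * (\<Prod>c\<in>J. T c)))"
    using insert.prems(5) by (simp add: n_subsets)
  finally have *: "of_nat fJ * (\<Sum>f\<in>signed_words (P c \<union> Q) V. g c f * (\<Prod>c\<in>J. g c f)) = \<dots>" .
  have "of_nat (\<Prod>c\<in>insert c J. fact (card (P c))) *
      (\<Sum>f\<in>signed_words (\<Union>c\<in>insert c J. P c) V. \<Prod>c\<in>insert c J. g c f) =
      of_nat (fact (card (P c))) *
      (of_nat fJ * (\<Sum>f\<in>signed_words (P c \<union> Q) V. g c f * (\<Prod>c\<in>J. g c f)))"
    using insert.hyps by (simp add: fJ_def Q_def mult_ac)
  also have "\<dots> = of_nat (fact (card (P c)) * fact (card Q) * (card V choose card (P c))) *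
      (T c * (\<Prod>c\<in>J. T c))"
    unfolding * by (simp only: of_nat_mult mult_ac)
  \<comment> \<open>The sizes of \<open>P c\<close> and \<open>Q\<close> add up to
    \<open>card V\<close>, so the binomial coefficient cancels against both factorials.\<close>
  also have "fact (card (P c)) * fact (card Q) * (card V choose card (P c)) = fact (card V)"
    using binomial_fact_lemma[of "card (P c)" "card V"] by (simp add: cardV)
  finally show ?case
    using insert.hyps by simp
qed

subsection \<open>Inversions\<close>

text \<open>The rank of an element is strictly increasing and smaller than \<open>card V\<close>; an
  injection between finite sets of equal size is onto.\<close>

lemma bij_betw_card_less:
  fixes V :: "'a::linorder set"
  assumes "finite V"
  shows "bij_betw (\<lambda>v. card {u\<in>V. u < v}) V {..<card V}"
proof -
  have mono: "card {u\<in>V. u < v} < card {u\<in>V. u < w}" if "v \<in> V" "v < w" for v w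
    using that assms by (intro psubset_card_mono) auto
  have "inj_on (\<lambda>v. card {u\<in>V. u < v}) V"
    by (rule linorder_inj_onI') (use mono in force)
  moreover have "(\<lambda>v. card {u\<in>V. u < v}) ` V \<subseteq> {..<card V}"
    using assms by (auto intro!: psubset_card_mono)
  ultimately show ?thesis
    by (simp add: bij_betw_def card_subset_eq card_image)
qed

lemma bij_betw_card_greater:
  fixes V :: "'a::linorder set"
  assumes "finite V"
  shows "bij_betw (\<lambda>v. card {u\<in>V. v < u}) V {..<card V}"
proof -
  have mono: "card {u\<in>V. w < u} < card {u\<in>V. v < u}" if "w \<in> V" "v < w" for v w
    using that assms by (intro psubset_card_mono) auto
  have "inj_on (\<lambda>v. card {u\<in>V. v < u}) V"
    by (rule linorder_inj_onI') (use mono in force)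
  moreover have "(\<lambda>v. card {u\<in>V. v < u}) ` V \<subseteq> {..<card V}"
    using assms by (auto intro!: psubset_card_mono)
  ultimately show ?thesis
    by (simp add: bij_betw_def card_subset_eq card_image)
qed

lemma sum_monom_card_less:
  fixes V :: "'a::linorder set"
  assumes "finite V"
  shows "(\<Sum>v\<in>V. monom 1 (card {u\<in>V. u < v})) = q_num (card V)"
  unfolding q_num_def by (rule sum.reindex_bij_betw[OF bij_betw_card_less[OF assms]])

lemma sum_monom_card_greater:
  fixes V :: "'a::linorder set"
  assumes "finite V"
  shows "(\<Sum>v\<in>V. monom 1 (card {u\<in>V. v < u})) = q_num (card V)"
  unfolding q_num_def by (rule sum.reindex_bij_betw[OF bij_betw_card_greater[OF assms]])

text \<open>\<open>e = 0\<close> gives the type D length and \<open>e = 1\<close> the type B length.\<close>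

definition signed_inv :: "nat \<Rightarrow> int set \<Rightarrow> (int \<Rightarrow> int) \<Rightarrow> nat" where
  "signed_inv e P f = card {(i, j). i \<in> P \<and> j \<in> P \<and> i < j \<and> f i > f j} +
     card {(i, j). i \<in> P \<and> j \<in> P \<and> i < j \<and> f i + f j < 0} + e * card {i\<in>P. f i < 0}"

text \<open>As \<open>p\<close> exceeds every position in \<open>P\<close>, the pairs gained are
  exactly those with second component \<open>p\<close>.\<close>

lemma card_pairs_insert_max:
  assumes "finite P" "\<forall>i\<in>P. i < p"
  shows "card {(i, j). i \<in> insert p P \<and> j \<in> insert p P \<and> i < j \<and> R i j} =
    card {(i, j). i \<in> P \<and> j \<in> P \<and> i < j \<and> R i j} + card {i\<in>P. R i (p::'a::linorder)}"
proof -
  define A where "A = {(i, j). i \<in> P \<and> j \<in> P \<and> i < j \<and> R i j}"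
  define B where "B = (\<lambda>i. (i, p)) ` {i\<in>P. R i p}"
  have "{(i, j). i \<in> insert p P \<and> j \<in> insert p P \<and> i < j \<and> R i j} = A \<union> B"
    using assms by (fastforce simp: A_def B_def)
  moreover have "finite A"
    unfolding A_def by (rule finite_subset[of _ "P \<times> P"]) (use assms in auto)
  moreover have "A \<inter> B = {}" "finite B"
    using assms by (auto simp: A_def B_def)
  moreover have "card B = card {i\<in>P. R i p}"
    unfolding B_def by (intro card_image inj_onI) simp
  ultimately show ?thesis
    by (simp add: card_Un_disjoint flip: A_def)
qed

lemma signed_inv_insert_max:
  assumes "finite P" "\<forall>i\<in>P. i < p"
  shows "signed_inv e (insert p P) f = signed_inv e P f +
    (card {i\<in>P. f i > f p} + card {i\<in>P. f i + f p < 0} + e * of_bool (f p < 0))"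
proof -
  have "card {i \<in> insert p P. f i < 0} = card {i\<in>P. f i < 0} + of_bool (f p < 0)"
  proof (cases "f p < 0")
    case True
    then have "{i \<in> insert p P. f i < 0} = insert p {i\<in>P. f i < 0}" by auto
    with True assms show ?thesis by auto
  next
    case False
    then have "{i \<in> insert p P. f i < 0} = {i\<in>P. f i < 0}" by auto
    with False show ?thesis by simp
  qed
  then show ?thesis
    unfolding signed_inv_def card_pairs_insert_max[OF assms] by (simp add: algebra_simps)
qed

lemma signed_inv_cong:
  assumes "\<And>i. i \<in> P \<Longrightarrow> f i = h i"
  shows "signed_inv e P f = signed_inv e P h"
  unfolding signed_inv_def using assms
  by (intro arg_cong2[where f = "(+)"] arg_cong2[where f = "(*)"] refl arg_cong[where f = card]) auto

lemma sum_signed_words_singleton: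
  fixes v :: int
  assumes "v > 0"
  shows "(\<Sum>a\<in>signed_words {p} {v}. g a) = g ((\<lambda>_. 0)(p := v)) + g ((\<lambda>_. 0)(p := - v))"
proof -
  have "signed_words {p} {v} = {(\<lambda>_. 0)(p := v), (\<lambda>_. 0)(p := - v)}"
  proof (intro equalityI subsetI)
    fix a assume a: "a \<in> signed_words {p} {v}"
    then have "\<bar>a p\<bar> = v" using signed_wordsD(3)[OF a, of p] by simp
    then have "a p = v \<or> a p = - v" by auto
    then show "a \<in> {(\<lambda>_. 0)(p := v), (\<lambda>_. 0)(p := - v)}"
      using signed_wordsD(1)[OF a] by (auto simp: fun_eq_iff)
  qed (use assms in \<open>auto simp: signed_words_def bij_betw_def\<close>)
  moreover have "(\<lambda>_. 0)(p := v) \<noteq> (\<lambda>_. 0)(p := - v)"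
    using assms by (auto dest: fun_cong[where x = p])
  ultimately show ?thesis by simp
qed

text \<open>The case of \<open>sum_signed_words_Un\<close> with a single position \<open>p\<close>
  split off: its value set is a singleton \<open>{v}\<close>, carried with either sign.\<close>

lemma sum_signed_words_insert:
  fixes g :: "('a \<Rightarrow> int) \<Rightarrow> 'r::comm_monoid_add"
  assumes "p \<notin> P" "finite P" "finite V" "V \<subseteq> {0<..}"
  shows "(\<Sum>f\<in>signed_words (insert p P) V. g f) =
    (\<Sum>v\<in>V. \<Sum>b\<in>signed_words P (V - {v}). g (b(p := v)) + g (b(p := - v)))"
proof -
  have "{U. U \<subseteq> V \<and> card U = card {p}} = (\<lambda>v. {v}) ` V"
    by (auto simp: card_1_singleton_iff)
  moreover have "(\<Sum>f\<in>signed_words ({p} \<union> P) V. g f) =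
    (\<Sum>U | U \<subseteq> V \<and> card U = card {p}.
      \<Sum>a\<in>signed_words {p} U. \<Sum>b\<in>signed_words P (V - U). g (\<lambda>i. a i + b i))"
    using assms by (intro sum_signed_words_Un) auto
  ultimately have "(\<Sum>f\<in>signed_words (insert p P) V. g f) =
    (\<Sum>v\<in>V. \<Sum>a\<in>signed_words {p} {v}. \<Sum>b\<in>signed_words P (V - {v}). g (\<lambda>i. a i + b i))"
    by (simp add: sum.reindex)
  also have "\<dots> = (\<Sum>v\<in>V. \<Sum>b\<in>signed_words P (V - {v}). g (b(p := v)) + g (b(p := - v)))"
  proof (rule sum.cong[OF refl])
    fix v assume "v \<in> V"
    then have "v > 0" using assms by auto
    have upd: "(\<lambda>i. ((\<lambda>_. 0)(p := w)) i + b i) = b(p := w)" if "b \<in> signed_words P (V - {v})" for b w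
      using signed_wordsD(1)[OF that assms(1)] by (auto simp: fun_eq_iff)
    show "(\<Sum>a\<in>signed_words {p} {v}. \<Sum>b\<in>signed_words P (V - {v}). g (\<lambda>i. a i + b i)) =
      (\<Sum>b\<in>signed_words P (V - {v}). g (b(p := v)) + g (b(p := - v)))"
      unfolding sum_signed_words_singleton[OF \<open>v > 0\<close>] sum.distrib
      using upd by (intro arg_cong2[where f = "(+)"] sum.cong refl) auto
  qed
  finally show ?thesis .
qed

text \<open>Turns a count of letters by absolute value into a count of values, which no longer
  depends on the arrangement \<open>b\<close>.\<close>

lemma card_abs_filter:
  assumes "b \<in> signed_words P W"
  shows "card {i\<in>P. Q \<bar>b i\<bar>} = card {u\<in>W. Q u}"
proof (rule bij_betw_same_card)
  show "bij_betw (\<lambda>i. \<bar>b i\<bar>) {i\<in>P. Q \<bar>b i\<bar>} {u\<in>W. Q u}"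
    using signed_wordsD(2)[OF assms] by (auto simp: bij_betw_def inj_on_def)
qed

text \<open>Remove the largest position. What its letter adds depends only on the signed value: a
  letter \<open>v\<close> adds the number of larger values, a letter \<open>- v\<close> adds
  \<open>card P + e\<close> plus the number of smaller ones. Summed over \<open>v\<close>, both
  number-of-values terms run through \<open>0, ..., card P\<close>, so one factor splits
  off.\<close>

lemma sum_signed_words_inv:
  assumes "finite P" "finite V" "V \<subseteq> {0<..}" "card V = card P"
  shows "(\<Sum>f\<in>signed_words P V. monom 1 (signed_inv e P f)) =
    (\<Prod>s=1..card P. q_num s * (1 + monom 1 (s - 1 + e)))"
  using assms
proof (induction P arbitrary: V rule: finite_linorder_max_induct)
  case empty
  then have "V = {}" by simp
  then show ?case by (simp add: signed_words_empty signed_inv_def)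
next
  case (insert p P)
  define T :: "int poly" where "T = (\<Prod>s=1..card P. q_num s * (1 + monom 1 (s - 1 + e)))"
  have p: "p \<notin> P" using insert.hyps by auto
  have cV: "card V = Suc (card P)" using insert.prems insert.hyps p by simp
  have "(\<Sum>b\<in>signed_words P (V - {v}). monom 1 (signed_inv e (insert p P) (b(p := v))) +
          monom 1 (signed_inv e (insert p P) (b(p := - v)))) =
        (monom 1 (card {u\<in>V. v < u}) + monom 1 (card P + e + card {u\<in>V. u < v})) * T"
    if v: "v \<in> V" for v
  proof -
    have pos: "v > 0" using insert.prems v by auto
    have old: "signed_inv e P (b(p := w)) = signed_inv e P b" for b w
      using p by (intro signed_inv_cong) auto
    have *: "signed_inv e (insert p P) (b(p := v)) = signed_inv e P b + card {u\<in>V. v < u} \<and>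
      signed_inv e (insert p P) (b(p := - v)) = signed_inv e P b + (card P + e + card {u\<in>V. u < v})"
      if b: "b \<in> signed_words P (V - {v})" for b
    proof -
      have ne: "\<bar>b i\<bar> \<noteq> v" if "i \<in> P" for i
        using signed_wordsD(3)[OF b that] by auto
      have sets: "{u\<in>V - {v}. v < u} = {u\<in>V. v < u}" "{u\<in>V - {v}. u < v} = {u\<in>V. u < v}"
        by auto
      \<comment> \<open>For positive \<open>v\<close> the conditions \<open>b i > v\<close> and
        \<open>b i < - v\<close> exclude each other and together say that
        \<open>\<bar>b i\<bar> > v\<close>.\<close>
      have "card {i\<in>P. b i > v} + card {i\<in>P. b i + v < 0} = card ({i\<in>P. b i > v} \<union> {i\<in>P. b i + v < 0})"
        using insert.hyps pos by (subst card_Un_disjoint) auto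
      also have "{i\<in>P. b i > v} \<union> {i\<in>P. b i + v < 0} = {i\<in>P. v < \<bar>b i\<bar>}"
        by auto
      also have "card \<dots> = card {u\<in>V. v < u}"
        using card_abs_filter[OF b, of "\<lambda>u. v < u"] by (simp only: sets)
      finally have 1: "card {i\<in>P. b i > v} + card {i\<in>P. b i + v < 0} = card {u\<in>V. v < u}" .
      \<comment> \<open>For the letter \<open>- v\<close> every \<open>i\<close> satisfies at least
        one of the two conditions, and satisfies both exactly when
        \<open>\<bar>b i\<bar> < v\<close>; hence the extra \<open>card P\<close>.\<close>
      have "card {i\<in>P. b i > - v} + card {i\<in>P. b i < v} =
        card ({i\<in>P. b i > - v} \<union> {i\<in>P. b i < v}) + card ({i\<in>P. b i > - v} \<inter> {i\<in>P. b i < v})"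
        using insert.hyps by (intro card_Un_Int) auto
      also have "{i\<in>P. b i > - v} \<union> {i\<in>P. b i < v} = P"
        using pos by auto
      also have "{i\<in>P. b i > - v} \<inter> {i\<in>P. b i < v} = {i\<in>P. \<bar>b i\<bar> < v}"
        by auto
      also have "card \<dots> = card {u\<in>V. u < v}"
        using card_abs_filter[OF b, of "\<lambda>u. u < v"] by (simp only: sets)
      finally have 2: "card {i\<in>P. b i > - v} + card {i\<in>P. b i < v} = card P + card {u\<in>V. u < v}" .
      have 3: "{i\<in>P. (b(p := w)) i > (b(p := w)) p} = {i\<in>P. b i > w}"
        "{i\<in>P. (b(p := w)) i + (b(p := w)) p < 0} = {i\<in>P. b i + w < 0}" for w
        using p by auto
      show ?thesis
        unfolding signed_inv_insert_max[OF insert.hyps(1,2)] old 3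
        using 1 2 pos by simp
    qed
    have "card (V - {v}) = card P" using cV v insert.prems by simp
    then have IH: "(\<Sum>b\<in>signed_words P (V - {v}). monom 1 (signed_inv e P b)) = T"
      unfolding T_def using insert.prems by (intro insert.IH) auto
    have "(\<Sum>b\<in>signed_words P (V - {v}). monom 1 (signed_inv e (insert p P) (b(p := v))) +
          monom 1 (signed_inv e (insert p P) (b(p := - v)))) =
      (\<Sum>b\<in>signed_words P (V - {v}).
        (monom 1 (card {u\<in>V. v < u}) + monom 1 (card P + e + card {u\<in>V. u < v})) *
        monom (1::int) (signed_inv e P b))"
      using * by (intro sum.cong refl) (simp add: mult_monom distrib_right add.commute)
    then show ?thesis by (simp only: IH flip: sum_distrib_left)
  qed
  then have "(\<Sum>f\<in>signed_words (insert p P) V. monom 1 (signed_inv e (insert p P) f)) =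
    (\<Sum>v\<in>V. (monom 1 (card {u\<in>V. v < u}) + monom 1 (card P + e) * monom 1 (card {u\<in>V. u < v})) * T)"
    using p insert by (subst sum_signed_words_insert) (auto simp: mult_monom)
  also have "\<dots> = (q_num (card V) + monom 1 (card P + e) * q_num (card V)) * T"
    using insert.prems
    by (simp only: sum.distrib sum_monom_card_less sum_monom_card_greater
        flip: sum_distrib_left sum_distrib_right)
  \<comment> \<open>The new factor is the one with \<open>s = card V = Suc (card P)\<close>, so its
    exponent \<open>s - 1 + e\<close> is \<open>card P + e\<close>.\<close>
  also have "\<dots> = (\<Prod>s=1..card (insert p P). q_num s * (1 + monom 1 (s - 1 + e)))"
    using p insert.hyps by (simp add: T_def cV algebra_simps)
  finally show ?case .
qed

section \<open>Closed forms of the type B and type D products\<close>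

lemma q_num_double: "q_num (2 * s) = q_num s * (1 + monom 1 s)"
proof -
  have "q_num (s + t) = q_num s + monom 1 s * q_num t" for t
    by (induction t) (simp_all add: q_num_def distrib_left mult_monom)
  from this[of s] show ?thesis by (simp only: mult_2 distrib_left mult_1_right mult.commute[of "monom 1 s"])
qed

lemma prod_q_num_type_B: "(\<Prod>s=1..m. q_num s * (1 + monom 1 (s - 1 + 1))) = q_even_dfact m"
  unfolding q_even_dfact_def by (intro prod.cong refl) (simp add: q_num_double)

text \<open>The factor \<open>1 + x^(s-1)\<close> pairs with the \<open>q_num (s - 1)\<close> of the
  preceding index to give \<open>q_num (2 * (s - 1))\<close>. Left over are \<open>q_num m\<close>
  at the top and \<open>1 + x^0 = 2\<close> at the bottom. For \<open>m = 0\<close> the right side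
  would be zero while the empty product is one.\<close>

lemma prod_q_num_type_D:
  assumes "m \<ge> 1"
  shows "(\<Prod>s=1..m. q_num s * (1 + monom 1 (s - 1 + 0))) = 2 * q_num m * q_even_dfact (m - 1)"
  using assms
proof (induction m rule: nat_induct_at_least)
  case base
  then show ?case by (simp add: q_num_def q_even_dfact_def)
next
  case (Suc m)
  have "q_even_dfact m = q_even_dfact (m - 1) * q_num (2 * m)"
    using Suc.hyps by (cases m) (simp_all add: q_even_dfact_def)
  then have "q_even_dfact m = q_even_dfact (m - 1) * (q_num m * (1 + monom 1 m))"
    by (simp only: q_num_double)
  then show ?case
    using Suc by (simp add: mult_ac)
qed

text \<open>Supplies the increasing enumeration used to standardise words: relabelling along it
  keeps all comparisons between letters. The induction adds the maximum \<open>b\<close> as the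
  value at the new last index.\<close>

lemma ex_strict_mono_bij_betw_card:
  fixes Z :: "'a::linorder set"
  assumes "finite Z"
  shows "\<exists>h. bij_betw h {1..int (card Z)} Z \<and> strict_mono_on {1..int (card Z)} h"
  using assms
proof (induction Z rule: finite_linorder_max_induct)
  case (insert b Z)
  then obtain h where h: "bij_betw h {1..int (card Z)} Z" "strict_mono_on {1..int (card Z)} h"
    by blast
  define n where "n = int (card Z)"
  have b: "b \<notin> Z" using insert.hyps by auto
  have S: "{1..int (card (insert b Z))} = insert (n + 1) {1..n}"
    using insert.hyps b by (auto simp: n_def)
  have "bij_betw (h(n + 1 := b)) {1..n} Z"
    using h(1) by (subst bij_betw_cong[where g = h]) (auto simp: n_def)
  then have "bij_betw (h(n + 1 := b)) (insert (n + 1) {1..n}) (insert b Z)"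
    using b notIn_Un_bij_betw[of "n + 1" "{1..n}" "h(n + 1 := b)" Z] by simp
  moreover have "strict_mono_on (insert (n + 1) {1..n}) (h(n + 1 := b))"
  proof (rule strict_mono_onI)
    fix x y assume xy: "x \<in> insert (n + 1) {1..n}" "y \<in> insert (n + 1) {1..n}" "x < y"
    then have x: "x \<in> {1..n}" "x \<noteq> n + 1" by auto
    then have "h x \<in> Z" using h(1) by (auto simp: n_def bij_betw_def)
    then show "(h(n + 1 := b)) x < (h(n + 1 := b)) y"
      using xy x insert.hyps strict_mono_onD[OF h(2), of x y] by (auto simp: n_def)
  qed
  ultimately show ?case unfolding S by blast
qed (auto simp: bij_betw_def strict_mono_on_def)

subsection \<open>Relabelling\<close>

text \<open>Here the letters themselves are prescribed, signs included: once the set of negated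
  values is fixed, a signed word is an arrangement of a fixed letter set.\<close>

definition words :: "'a set \<Rightarrow> int set \<Rightarrow> ('a \<Rightarrow> int) set" where
  "words P Z = {f. (\<forall>i. i \<notin> P \<longrightarrow> f i = 0) \<and> bij_betw f P Z}"

lemma bij_betw_abs_signs:
  assumes "V \<subseteq> {0<..}" "N \<subseteq> V"
  shows "bij_betw abs ((V - N) \<union> uminus ` N) (V :: int set)"
  unfolding bij_betw_def
proof
  show "inj_on abs ((V - N) \<union> uminus ` N)"
    using assms by (fastforce simp: inj_on_def abs_if split: if_splits)
  have "abs ` ((V - N) \<union> uminus ` N) = (V - N) \<union> N"
    using assms by (force simp: image_Un image_image)
  then show "abs ` ((V - N) \<union> uminus ` N) = V" using assms by auto
qed

text \<open>Group the words by the set \<open>N\<close> of absolute values that occur with a minus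
  sign (\<open>key\<close> below); \<open>N\<close> determines the letter set, and
  conversely.\<close>

lemma sum_signed_words_signs:
  fixes g :: "('a \<Rightarrow> int) \<Rightarrow> 'r::comm_monoid_add"
  assumes "finite P" "finite V" "V \<subseteq> {0<..}"
  shows "(\<Sum>f\<in>signed_words P V. g f) = (\<Sum>N\<in>Pow V. \<Sum>f\<in>words P ((V - N) \<union> uminus ` N). g f)"
proof -
  define key where "key = (\<lambda>f::'a \<Rightarrow> int. {v\<in>V. - v \<in> f ` P})"
  have "{f. f \<in> signed_words P V \<and> key f = N} = words P ((V - N) \<union> uminus ` N)" if N: "N \<subseteq> V" for N
  proof (intro equalityI subsetI)
    fix f assume "f \<in> {f. f \<in> signed_words P V \<and> key f = N}"
    then have f: "f \<in> signed_words P V" and k: "N = {v\<in>V. - v \<in> f ` P}" by (auto simp: key_def)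
    have inj: "i = j" if "i \<in> P" "j \<in> P" "\<bar>f i\<bar> = \<bar>f j\<bar>" for i j
      using signed_wordsD(2)[OF f] that by (auto simp: bij_betw_def inj_on_def)
    have "f ` P = (V - N) \<union> uminus ` N"
    proof (intro equalityI subsetI)
      fix y assume "y \<in> f ` P"
      then obtain i where i: "i \<in> P" "y = f i" by auto
      have V: "\<bar>y\<bar> \<in> V" using signed_wordsD(3)[OF f i(1)] i by simp
      then have "\<bar>y\<bar> > 0" using assms(3) by auto
      show "y \<in> (V - N) \<union> uminus ` N"
      proof (cases "y > 0")
        case True
        have "- y \<notin> f ` P"
        proof
          assume "- y \<in> f ` P"
          then obtain j where j: "j \<in> P" "- y = f j" by auto
          then have "i = j" using i by (intro inj) auto
          then show False using i j True by simp
        qed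
        then show ?thesis using True V by (auto simp: k)
      next
        case False
        then have "- y \<in> N" using V \<open>y \<in> f ` P\<close> by (auto simp: k)
        then show ?thesis by (auto intro: image_eqI[where x = "- y"])
      qed
    next
      fix y assume y: "y \<in> (V - N) \<union> uminus ` N"
      show "y \<in> f ` P"
      proof (cases "y \<in> V - N")
        case True
        then obtain i where "i \<in> P" "\<bar>f i\<bar> = y"
          using signed_wordsD(2)[OF f] by (auto simp: bij_betw_def)
        moreover have "- y \<notin> f ` P" using True by (auto simp: k)
        ultimately show ?thesis by (auto simp: abs_if split: if_splits)
      qed (use y in \<open>auto simp: k\<close>)
    qed
    moreover have "inj_on f P" using inj by (auto simp: inj_on_def)
    ultimately show "f \<in> words P ((V - N) \<union> uminus ` N)"
      using signed_wordsD(1)[OF f] by (auto simp: words_def bij_betw_def)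
  next
    fix f assume "f \<in> words P ((V - N) \<union> uminus ` N)"
    then have f0: "\<And>i. i \<notin> P \<Longrightarrow> f i = 0" and f: "bij_betw f P ((V - N) \<union> uminus ` N)"
      by (auto simp: words_def)
    have "- v \<notin> V" if "v \<in> V" for v
      using that subsetD[OF assms(3), of v] subsetD[OF assms(3), of "- v"] by auto
    then have "{v\<in>V. - v \<in> (V - N) \<union> uminus ` N} = N"
      using N by auto
    then have "key f = N"
      using f by (simp only: key_def bij_betw_def)
    moreover have "bij_betw (\<lambda>i. \<bar>f i\<bar>) P V"
      using bij_betw_trans[OF f bij_betw_abs_signs[OF assms(3) N]] by (simp add: o_def)
    ultimately show "f \<in> {f. f \<in> signed_words P V \<and> key f = N}"
      using f0 by (simp add: signed_words_def)
  qed
  moreover have "(\<Sum>f\<in>signed_words P V. g f) =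
      (\<Sum>N\<in>Pow V. \<Sum>f | f \<in> signed_words P V \<and> key f = N. g f)"
    using assms finite_signed_words by (intro sum.group[symmetric]) (auto simp: key_def)
  ultimately show ?thesis by simp
qed

text \<open>Transporting positions along \<open>p\<close> and letters along \<open>h\<close> to the
  common index set \<open>S\<close> turns a word into a permutation. The two default values differ:
  a permutation is the identity off \<open>S\<close>, a word is zero off \<open>P\<close>.\<close>

lemma sum_words_permutes:
  fixes g :: "('a \<Rightarrow> int) \<Rightarrow> 'r::comm_monoid_add"
  assumes p: "bij_betw p S P" and h: "bij_betw h S Z"
  shows "(\<Sum>f\<in>words P Z. g f) =
    (\<Sum>\<sigma> | \<sigma> permutes S. g (\<lambda>i. if i \<in> P then h (\<sigma> (inv_into S p i)) else 0))"
proof (rule sum.reindex_bij_witness[symmetric,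
    where i = "\<lambda>f m. if m \<in> S then inv_into S h (f (p m)) else m"
      and j = "\<lambda>\<sigma> i. if i \<in> P then h (\<sigma> (inv_into S p i)) else 0"])
  fix \<sigma> assume "\<sigma> \<in> {\<sigma>. \<sigma> permutes S}"
  then have \<sigma>: "\<sigma> permutes S" by simp
  show "(\<lambda>m. if m \<in> S then
      inv_into S h (if p m \<in> P then h (\<sigma> (inv_into S p (p m))) else 0) else m) = \<sigma>"
    using bij_betw_apply[OF p] permutes_in_image[OF \<sigma>] permutes_not_in[OF \<sigma>]
    by (auto simp: fun_eq_iff bij_betw_inv_into_left[OF p] bij_betw_inv_into_left[OF h])
  have "bij_betw (h \<circ> (\<sigma> \<circ> inv_into S p)) P Z"
    by (intro bij_betw_trans[OF _ h] bij_betw_trans[OF bij_betw_inv_into[OF p]]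
        permutes_imp_bij[OF \<sigma>])
  then have "bij_betw (\<lambda>i. if i \<in> P then h (\<sigma> (inv_into S p i)) else 0) P Z"
    by (subst bij_betw_cong[where g = "h \<circ> (\<sigma> \<circ> inv_into S p)"]) auto
  then show "(\<lambda>i. if i \<in> P then h (\<sigma> (inv_into S p i)) else 0) \<in> words P Z"
    by (simp add: words_def)
next
  fix f assume "f \<in> words P Z"
  then have f0: "\<And>i. i \<notin> P \<Longrightarrow> f i = 0" and f: "bij_betw f P Z"
    by (auto simp: words_def)
  show "(\<lambda>i. if i \<in> P then h (if inv_into S p i \<in> S
      then inv_into S h (f (p (inv_into S p i))) else inv_into S p i) else 0) = f"
    using bij_betw_apply[OF bij_betw_inv_into[OF p]] bij_betw_apply[OF f] f0
    by (auto simp: fun_eq_iff bij_betw_inv_into_right[OF p] bij_betw_inv_into_right[OF h])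
  have "bij_betw (inv_into S h \<circ> (f \<circ> p)) S S"
    by (intro bij_betw_trans[OF _ bij_betw_inv_into[OF h]] bij_betw_trans[OF p] f)
  then have "bij_betw (\<lambda>m. if m \<in> S then inv_into S h (f (p m)) else m) S S"
    by (subst bij_betw_cong[where g = "inv_into S h \<circ> (f \<circ> p)"]) auto
  then have "(\<lambda>m. if m \<in> S then inv_into S h (f (p m)) else m) permutes S"
    by (rule bij_imp_permutes) auto
  then show "(\<lambda>m. if m \<in> S then inv_into S h (f (p m)) else m) \<in> {\<sigma>. \<sigma> permutes S}"
    by simp
qed simp

lemma sgn_mult_abs_image:
  fixes h :: "int \<Rightarrow> int"
  assumes "h \<bar>x\<bar> > 0" "x \<noteq> 0"
  shows "\<bar>sgn x * h \<bar>x\<bar>\<bar> = h \<bar>x\<bar>" "sgn (sgn x * h \<bar>x\<bar>) = sgn x"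
  using assms by (auto simp: abs_mult sgn_mult)

text \<open>Relabelling acts on absolute values and must keep signs, hence the odd extension
  \<open>sgn x * h \<bar>x\<bar>\<close> of \<open>h\<close>. Positivity of both value sets excludes
  zero letters, on which the sign would be lost.\<close>

lemma signed_words_relabel:
  assumes "f \<in> signed_words P V" "bij_betw q Q P" "bij_betw h V U" "V \<subseteq> {0<..}" "U \<subseteq> {0<..}"
  shows "(\<lambda>i. if i \<in> Q then sgn (f (q i)) * h \<bar>f (q i)\<bar> else 0) \<in> signed_words Q U"
proof -
  have bij: "bij_betw (h \<circ> ((\<lambda>i. \<bar>f i\<bar>) \<circ> q)) Q U"
    by (intro bij_betw_trans[OF _ assms(3)] bij_betw_trans[OF assms(2)] signed_wordsD(2)[OF assms(1)])
  have eq: "\<bar>if i \<in> Q then sgn (f (q i)) * h \<bar>f (q i)\<bar> else 0\<bar> = (h \<circ> ((\<lambda>i. \<bar>f i\<bar>) \<circ> q)) i"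
    if "i \<in> Q" for i
  proof -
    have V: "\<bar>f (q i)\<bar> \<in> V"
      by (intro signed_wordsD(3)[OF assms(1)] bij_betw_apply[OF assms(2)] that)
    moreover have "h \<bar>f (q i)\<bar> \<in> U" by (rule bij_betw_apply[OF assms(3) V])
    ultimately have "h \<bar>f (q i)\<bar> > 0" "f (q i) \<noteq> 0" using assms(4,5) by auto
    then show ?thesis using that by (simp add: sgn_mult_abs_image)
  qed
  have "bij_betw (\<lambda>i. \<bar>if i \<in> Q then sgn (f (q i)) * h \<bar>f (q i)\<bar> else 0\<bar>) Q U"
    by (rule iffD2[OF bij_betw_cong[OF eq] bij])
  then show ?thesis by (simp add: signed_words_def)
qed

text \<open>Only one-sided inverses are assumed, so the lemma serves both compositions in the
  bijection that follows.\<close>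

lemma signed_words_relabel_inverse:
  assumes "f \<in> signed_words P V" "V \<subseteq> {0<..}" "U \<subseteq> {0<..}"
    and "\<And>i. i \<in> P \<Longrightarrow> q' i \<in> Q \<and> q (q' i) = i" and "\<And>v. v \<in> V \<Longrightarrow> h v \<in> U \<and> h' (h v) = v"
  shows "(\<lambda>i. if i \<in> P then
      sgn (if q' i \<in> Q then sgn (f (q (q' i))) * h \<bar>f (q (q' i))\<bar> else 0) *
      h' \<bar>if q' i \<in> Q then sgn (f (q (q' i))) * h \<bar>f (q (q' i))\<bar> else 0\<bar> else 0) = f"
proof
  fix i
  show "(if i \<in> P then
      sgn (if q' i \<in> Q then sgn (f (q (q' i))) * h \<bar>f (q (q' i))\<bar> else 0) *
      h' \<bar>if q' i \<in> Q then sgn (f (q (q' i))) * h \<bar>f (q (q' i))\<bar> else 0\<bar> else 0) = f i"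
  proof (cases "i \<in> P")
    case True
    then have V: "\<bar>f i\<bar> \<in> V" by (rule signed_wordsD(3)[OF assms(1)])
    then have "h \<bar>f i\<bar> > 0" "f i \<noteq> 0" using assms(2,3) assms(5)[OF V] by auto
    then show ?thesis
      using True assms(4)[OF True] assms(5)[OF V] by (simp add: sgn_mult_abs_image sgn_mult_abs)
  qed (simp add: signed_wordsD(1)[OF assms(1)])
qed

lemma sum_signed_words_relabel:
  fixes g :: "('b \<Rightarrow> int) \<Rightarrow> 'r::comm_monoid_add"
  assumes "bij_betw p P Q" "bij_betw h V U" "V \<subseteq> {0<..}" "U \<subseteq> {0<..}"
  shows "(\<Sum>f\<in>signed_words Q U. g f) =
    (\<Sum>f\<in>signed_words P V. g (\<lambda>i. if i \<in> Q then
       sgn (f (inv_into P p i)) * h \<bar>f (inv_into P p i)\<bar> else 0))"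
proof (rule sum.reindex_bij_witness[symmetric,
    where i = "\<lambda>f i. if i \<in> P then sgn (f (p i)) * inv_into V h \<bar>f (p i)\<bar> else 0"
      and j = "\<lambda>f i. if i \<in> Q then sgn (f (inv_into P p i)) * h \<bar>f (inv_into P p i)\<bar> else 0"])
  note inv = bij_betw_inv_into[OF assms(1)] bij_betw_inv_into[OF assms(2)]
  note app = bij_betw_apply[OF assms(1)] bij_betw_apply[OF assms(2)]
    bij_betw_apply[OF inv(1)] bij_betw_apply[OF inv(2)]
  note left_right = bij_betw_inv_into_left[OF assms(1)] bij_betw_inv_into_right[OF assms(1)]
    bij_betw_inv_into_left[OF assms(2)] bij_betw_inv_into_right[OF assms(2)]
  fix f assume f: "f \<in> signed_words P V"
  show "(\<lambda>i. if i \<in> Q then sgn (f (inv_into P p i)) * h \<bar>f (inv_into P p i)\<bar> else 0) \<in> signed_words Q U"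
    using f inv(1) assms(2-4) by (rule signed_words_relabel)
  show "(\<lambda>i. if i \<in> P then
      sgn (if p i \<in> Q then sgn (f (inv_into P p (p i))) * h \<bar>f (inv_into P p (p i))\<bar> else 0) *
      inv_into V h \<bar>if p i \<in> Q then sgn (f (inv_into P p (p i))) * h \<bar>f (inv_into P p (p i))\<bar> else 0\<bar>
      else 0) = f"
    using f assms(3,4) by (rule signed_words_relabel_inverse) (simp_all add: app left_right)
next
  note inv = bij_betw_inv_into[OF assms(1)] bij_betw_inv_into[OF assms(2)]
  note app = bij_betw_apply[OF assms(1)] bij_betw_apply[OF assms(2)]
    bij_betw_apply[OF inv(1)] bij_betw_apply[OF inv(2)]
  note left_right = bij_betw_inv_into_left[OF assms(1)] bij_betw_inv_into_right[OF assms(1)]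
    bij_betw_inv_into_left[OF assms(2)] bij_betw_inv_into_right[OF assms(2)]
  fix f assume f: "f \<in> signed_words Q U"
  show "(\<lambda>i. if i \<in> P then sgn (f (p i)) * inv_into V h \<bar>f (p i)\<bar> else 0) \<in> signed_words P V"
    using f assms(1) inv(2) assms(4,3) by (rule signed_words_relabel)
  show "(\<lambda>i. if i \<in> Q then
      sgn (if inv_into P p i \<in> P then sgn (f (p (inv_into P p i))) * inv_into V h \<bar>f (p (inv_into P p i))\<bar> else 0) *
      h \<bar>if inv_into P p i \<in> P then sgn (f (p (inv_into P p i))) * inv_into V h \<bar>f (p (inv_into P p i))\<bar> else 0\<bar>
      else 0) = f"
    using f assms(4,3) by (rule signed_words_relabel_inverse) (simp_all add: app left_right)
qed simp

section \<open>Signed permutations as signed words on the positive positions\<close>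

lemma signed_permsD:
  assumes "\<pi> \<in> signed_perms n"
  shows "\<pi> permutes {- int n..int n} - {0}" "\<pi> (- i) = - \<pi> i"
  using assms by (auto simp: signed_perms_def)

text \<open>Equal absolute values mean \<open>\<pi> i = \<pi> j\<close> or
  \<open>\<pi> i = \<pi> (- j)\<close>, and two positive positions cannot be opposite. Surjectivity
  follows by finiteness.\<close>

lemma bij_betw_abs_signed_perms:
  assumes "\<pi> \<in> signed_perms n"
  shows "bij_betw (\<lambda>i. \<bar>\<pi> i\<bar>) {1..int n} {1..int n}"
proof -
  have "inj_on (\<lambda>i. \<bar>\<pi> i\<bar>) {1..int n}"
  proof (rule inj_onI)
    fix i j assume ij: "i \<in> {1..int n}" "j \<in> {1..int n}" and "\<bar>\<pi> i\<bar> = \<bar>\<pi> j\<bar>"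
    then have "\<pi> i = \<pi> j \<or> \<pi> i = \<pi> (- j)"
      by (auto simp: abs_if signed_permsD(2)[OF assms] split: if_splits)
    then have "i = j \<or> i = - j"
      using permutes_inj[OF signed_permsD(1)[OF assms]] by (auto dest: injD)
    then show "i = j" using ij by auto
  qed
  moreover have "(\<lambda>i. \<bar>\<pi> i\<bar>) ` {1..int n} \<subseteq> {1..int n}"
  proof clarify
    fix i assume "i \<in> {1..int n}"
    then have "\<pi> i \<in> {- int n..int n} - {0}"
      by (subst permutes_in_image[OF signed_permsD(1)[OF assms]]) auto
    then show "\<bar>\<pi> i\<bar> \<in> {1..int n}" by auto
  qed
  ultimately show ?thesis
    by (simp add: bij_betw_def endo_inj_surj)
qed

lemma signed_perms_extend:
  assumes "f \<in> signed_words {1..int n} {1..int n}"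
  shows "(\<lambda>m. if m \<in> {1..int n} then f m else if - m \<in> {1..int n} then - f (- m) else m) \<in> signed_perms n"
    (is "?\<pi> \<in> _")
proof -
  have abs: "\<bar>?\<pi> m\<bar> = \<bar>f \<bar>m\<bar>\<bar>" if "\<bar>m\<bar> \<in> {1..int n}" for m
    using that by (auto simp: abs_if)
  have range: "\<bar>f m\<bar> \<in> {1..int n}" if "m \<in> {1..int n}" for m
    by (rule signed_wordsD(3)[OF assms that])
  have S: "m \<in> {- int n..int n} - {0} \<longleftrightarrow> \<bar>m\<bar> \<in> {1..int n}" for m
    by auto
  have odd: "?\<pi> (- m) = - ?\<pi> m" for m
    by auto
  have inj: "inj_on ?\<pi> ({- int n..int n} - {0})"
  proof (rule inj_onI)
    fix i j assume i: "i \<in> {- int n..int n} - {0}" and j: "j \<in> {- int n..int n} - {0}"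
      and eq: "?\<pi> i = ?\<pi> j"
    have "\<bar>f \<bar>i\<bar>\<bar> = \<bar>f \<bar>j\<bar>\<bar>"
      using abs[of i] abs[of j] i j eq unfolding S by simp
    then have "\<bar>i\<bar> = \<bar>j\<bar>"
      using i j signed_wordsD(2)[OF assms] unfolding S by (auto simp: bij_betw_def inj_on_def)
    then have "i = j \<or> i = - j" by auto
    \<comment> \<open>This rules out \<open>i = - j\<close>: oddness would then give
      \<open>?\<pi> j = - ?\<pi> j\<close>.\<close>
    moreover have "?\<pi> j \<noteq> 0"
      using abs[of j] range[of "\<bar>j\<bar>"] j unfolding S by auto
    ultimately show "i = j" using eq odd[of j] by fastforce
  qed
  have "?\<pi> ` ({- int n..int n} - {0}) \<subseteq> {- int n..int n} - {0}"
    using abs range unfolding image_subset_iff S by simp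
  then have "?\<pi> ` ({- int n..int n} - {0}) = {- int n..int n} - {0}"
    by (intro endo_inj_surj inj) simp_all
  with inj have "bij_betw ?\<pi> ({- int n..int n} - {0}) ({- int n..int n} - {0})"
    by (rule bij_betw_imageI)
  then have "?\<pi> permutes {- int n..int n} - {0}"
    by (rule bij_imp_permutes) auto
  with odd show ?thesis by (simp add: signed_perms_def)
qed

text \<open>Oddness recovers the values at negative positions from those at positive ones, and
  everything else is fixed.\<close>

lemma sum_signed_perms:
  fixes g :: "(int \<Rightarrow> int) \<Rightarrow> 'r::comm_monoid_add"
  shows "(\<Sum>\<pi>\<in>signed_perms n. g (\<lambda>i. if i \<in> {1..int n} then \<pi> i else 0)) =
    (\<Sum>f\<in>signed_words {1..int n} {1..int n}. g f)"
proof (rule sum.reindex_bij_witness[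
    where i = "\<lambda>f m. if m \<in> {1..int n} then f m else if - m \<in> {1..int n} then - f (- m) else m"
      and j = "\<lambda>\<pi> i. if i \<in> {1..int n} then \<pi> i else 0"])
  fix \<pi> assume \<pi>: "\<pi> \<in> signed_perms n"
  show "(\<lambda>m. if m \<in> {1..int n} then if m \<in> {1..int n} then \<pi> m else 0
      else if - m \<in> {1..int n} then - (if - m \<in> {1..int n} then \<pi> (- m) else 0) else m) = \<pi>"
  proof
    fix m
    have "\<pi> m = m" if "m \<notin> {1..int n}" "- m \<notin> {1..int n}"
      using that by (intro permutes_not_in[OF signed_permsD(1)[OF \<pi>]]) auto
    then show "(if m \<in> {1..int n} then if m \<in> {1..int n} then \<pi> m else 0
      else if - m \<in> {1..int n} then - (if - m \<in> {1..int n} then \<pi> (- m) else 0) else m) = \<pi> m"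
      using signed_permsD(2)[OF \<pi>, of m] by simp
  qed
  show "(\<lambda>i. if i \<in> {1..int n} then \<pi> i else 0) \<in> signed_words {1..int n} {1..int n}"
  proof -
    have "bij_betw (\<lambda>i. \<bar>if i \<in> {1..int n} then \<pi> i else 0\<bar>) {1..int n} {1..int n}"
      by (rule iffD2[OF bij_betw_cong bij_betw_abs_signed_perms[OF \<pi>]]) simp
    then show ?thesis by (simp add: signed_words_def)
  qed
next
  fix f assume f: "f \<in> signed_words {1..int n} {1..int n}"
  then show "(\<lambda>m. if m \<in> {1..int n} then f m else if - m \<in> {1..int n} then - f (- m) else m) \<in> signed_perms n"
    by (rule signed_perms_extend)
  show "(\<lambda>i. if i \<in> {1..int n} then if i \<in> {1..int n} then f i else
      if - i \<in> {1..int n} then - f (- i) else i else 0) = f"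
    using signed_wordsD(1)[OF f] by auto
qed simp

subsection \<open>Descents\<close>

definition des_on :: "nat \<Rightarrow> int set \<Rightarrow> (int \<Rightarrow> int) \<Rightarrow> nat" where
  "des_on k P f = card {i\<in>P. i + int k \<in> P \<and> f i > f (i + int k)}"

lemma des_on_cong:
  assumes "\<And>i. i \<in> P \<Longrightarrow> f i = h i"
  shows "des_on k P f = des_on k P h"
  unfolding des_on_def using assms by (intro arg_cong[where f = card]) auto

lemma des_A_cong:
  assumes "k \<ge> 1" "\<And>i. i \<in> {1..int n} \<Longrightarrow> f i = h i"
  shows "des_A n k f = des_A n k h"
  unfolding des_A_def using assms by (intro arg_cong[where f = card]) auto

lemma bij_betw_progression:
  assumes "k \<ge> 1"
  shows "bij_betw (\<lambda>m. a + m * int k) A ((\<lambda>m. a + m * int k) ` A)"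
  using assms by (intro inj_on_imp_bij_betw) (auto simp: inj_on_def)

text \<open>A step of \<open>k\<close> along the progression is a step of one in its index, so these
  are the ordinary descents of the subword.\<close>

lemma des_on_progression:
  assumes "k \<ge> 1"
  shows "des_on k ((\<lambda>m. a + m * int k) ` {1..int s}) f = des_A s 1 (\<lambda>m. f (a + m * int k))"
proof -
  have next_pos: "a + m * int k + int k = a + (m + 1) * int k" for m
    by (simp add: algebra_simps)
  have mem: "a + m * int k \<in> (\<lambda>m. a + m * int k) ` {1..int s} \<longleftrightarrow> m \<in> {1..int s}" for m
    using assms by auto
  have "bij_betw (\<lambda>m. a + m * int k)
      {i. 1 \<le> i \<and> i \<le> int s - int 1 \<and> f (a + i * int k) > f (a + (i + int 1) * int k)}
      {i \<in> (\<lambda>m. a + m * int k) ` {1..int s}.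
        i + int k \<in> (\<lambda>m. a + m * int k) ` {1..int s} \<and> f i > f (i + int k)}"
    unfolding bij_betw_def
  proof (intro conjI equalityI subsetI)
    show "inj_on (\<lambda>m. a + m * int k)
      {i. 1 \<le> i \<and> i \<le> int s - int 1 \<and> f (a + i * int k) > f (a + (i + int 1) * int k)}"
      using assms by (auto simp: inj_on_def)
  next
    fix x assume "x \<in> (\<lambda>m. a + m * int k) `
      {i. 1 \<le> i \<and> i \<le> int s - int 1 \<and> f (a + i * int k) > f (a + (i + int 1) * int k)}"
    then obtain m where m: "x = a + m * int k" "1 \<le> m" "m \<le> int s - 1"
      "f (a + m * int k) > f (a + (m + 1) * int k)" by auto
    then show "x \<in> {i \<in> (\<lambda>m. a + m * int k) ` {1..int s}.
        i + int k \<in> (\<lambda>m. a + m * int k) ` {1..int s} \<and> f i > f (i + int k)}"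
      by (simp add: next_pos mem)
  next
    fix x assume x: "x \<in> {i \<in> (\<lambda>m. a + m * int k) ` {1..int s}.
        i + int k \<in> (\<lambda>m. a + m * int k) ` {1..int s} \<and> f i > f (i + int k)}"
    then have "x \<in> (\<lambda>m. a + m * int k) ` {1..int s}" by simp
    then obtain m where m: "x = a + m * int k" "m \<in> {1..int s}" by (rule imageE)
    have "m + 1 \<in> {1..int s}" "f (a + m * int k) > f (a + (m + 1) * int k)"
      using x unfolding m(1) next_pos mem mem_Collect_eq by simp_all
    with m show "x \<in> (\<lambda>m. a + m * int k) `
      {i. 1 \<le> i \<and> i \<le> int s - int 1 \<and> f (a + i * int k) > f (a + (i + int 1) * int k)}"
      by (intro image_eqI[where x = m]) auto
  qed
  then show ?thesis
    unfolding des_on_def des_A_def by (rule bij_betw_same_card[symmetric])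
qed

lemma des_A_strict_mono:
  assumes "strict_mono_on Z h" "\<And>i. i \<in> {1..int s} \<Longrightarrow> \<sigma> i \<in> Z"
  shows "des_A s 1 (\<lambda>i. h (\<sigma> i)) = des_A s 1 \<sigma>"
proof -
  have "h (\<sigma> i) > h (\<sigma> (i + 1)) \<longleftrightarrow> \<sigma> i > \<sigma> (i + 1)" if "1 \<le> i" "i \<le> int s - 1" for i
    using that by (intro strict_mono_on_less[OF assms(1)] assms(2)) auto
  then show ?thesis
    unfolding des_A_def by (intro arg_cong[where f = card]) auto
qed

lemma pcompose_monom_monom:
  "pcompose (monom 1 m) (monom 1 e) = monom (1::'a::comm_semiring_1) (e * m)"
  by (induction m) (simp_all add: monom_0 monom_Suc pcompose_pCons mult_monom)

text \<open>The weight \<open>e\<close> is \<open>1\<close> for \<open>des_B\<close> and \<open>2\<close> for \<open>fdes_B\<close>.\<close>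

lemma sum_perms_pcompose:
  "(\<Sum>\<sigma>\<in>perms s. monom 1 (e * des_A s 1 \<sigma>)) = pcompose (eulerian_A s) (monom 1 e)"
  by (simp add: eulerian_A_def pcompose_sum pcompose_monom_monom)

text \<open>Standardisation: index the progression by \<open>{1..s}\<close> and replace letters by
  their ranks. Both preserve descents, so the letter set \<open>Z\<close> matters only through its
  size.\<close>

lemma sum_words_des:
  fixes a :: int
  assumes "k \<ge> 1" "finite Z" "card Z = s"
  defines "P \<equiv> (\<lambda>m. a + m * int k) ` {1..int s}"
  shows "(\<Sum>f\<in>words P Z. monom 1 (e * des_on k P f)) = pcompose (eulerian_A s) (monom 1 e)"
proof -
  obtain h where h: "bij_betw h {1..int s} Z" "strict_mono_on {1..int s} h"
    using ex_strict_mono_bij_betw_card[OF assms(2)] assms(3) by auto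
  have p: "bij_betw (\<lambda>m. a + m * int k) {1..int s} P"
    unfolding P_def by (rule bij_betw_progression[OF assms(1)])
  have "(\<Sum>f\<in>words P Z. monom (1::int) (e * des_on k P f)) =
    (\<Sum>\<sigma> | \<sigma> permutes {1..int s}. monom 1 (e * des_A s 1 \<sigma>))"
    unfolding sum_words_permutes[OF p h(1)]
  proof (rule sum.cong[OF refl])
    fix \<sigma> assume "\<sigma> \<in> {\<sigma>. \<sigma> permutes {1..int s}}"
    then have \<sigma>: "\<sigma> permutes {1..int s}" by simp
    let ?f = "\<lambda>i. if i \<in> P then h (\<sigma> (inv_into {1..int s} (\<lambda>m. a + m * int k) i)) else 0"
    have "des_on k P ?f = des_A s 1 (\<lambda>m. ?f (a + m * int k))"
      unfolding P_def by (rule des_on_progression[OF assms(1)])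
    also have "\<dots> = des_A s 1 (\<lambda>m. h (\<sigma> m))"
    proof (rule des_A_cong)
      fix m assume m: "m \<in> {1..int s}"
      then have "a + m * int k \<in> P" unfolding P_def by (rule imageI)
      then show "?f (a + m * int k) = h (\<sigma> m)"
        using bij_betw_inv_into_left[OF p m] by simp
    qed simp
    also have "\<dots> = des_A s 1 \<sigma>"
      using h(2) by (rule des_A_strict_mono) (simp only: permutes_in_image[OF \<sigma>])
    finally show "monom 1 (e * des_on k P ?f) = monom 1 (e * des_A s 1 \<sigma>)" by simp
  qed
  then show ?thesis
    using sum_perms_pcompose[where e = e and s = s] by (simp add: perms_def)
qed

text \<open>Each of the \<open>2 ^ s\<close> choices of negated values leaves \<open>s\<close>
  distinct letters, to which \<open>sum_words_des\<close> applies.\<close>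

lemma sum_signed_words_des:
  fixes a :: int
  assumes "k \<ge> 1" "finite U" "U \<subseteq> {0<..}" "card U = s"
  defines "P \<equiv> (\<lambda>m. a + m * int k) ` {1..int s}"
  shows "(\<Sum>f\<in>signed_words P U. monom 1 (e * des_on k P f)) =
    2 ^ s * pcompose (eulerian_A s) (monom 1 e)"
proof -
  have "(\<Sum>f\<in>words P ((U - N) \<union> uminus ` N). monom 1 (e * des_on k P f)) =
      pcompose (eulerian_A s) (monom 1 e)" if "N \<subseteq> U" for N
    unfolding P_def
  proof (rule sum_words_des[OF assms(1)])
    show "finite ((U - N) \<union> uminus ` N)"
      using that assms(2) by (auto intro: finite_subset)
    show "card ((U - N) \<union> uminus ` N) = s"
      using bij_betw_same_card[OF bij_betw_abs_signs[OF assms(3) that]] assms(4) by simp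
  qed
  then have "(\<Sum>f\<in>signed_words P U. monom (1::int) (e * des_on k P f)) =
      (\<Sum>N\<in>Pow U. pcompose (eulerian_A s) (monom 1 e))"
    using assms(2,3) by (subst sum_signed_words_signs) (auto simp: P_def)
  also have "\<dots> = 2 ^ s * pcompose (eulerian_A s) (monom 1 e)"
    using assms(2,4) by (simp add: card_Pow)
  finally show ?thesis .
qed

text \<open>Ensures that an increasing relabelling of absolute values also keeps comparisons between
  letters of arbitrary sign, hence descents.\<close>

lemma strict_mono_on_odd_extension:
  fixes h :: "int \<Rightarrow> int"
  assumes "strict_mono_on V h" "\<And>v. v \<in> V \<Longrightarrow> h v > 0"
  shows "strict_mono_on {x. \<bar>x\<bar> \<in> V} (\<lambda>x. sgn x * h \<bar>x\<bar>)"
proof (rule strict_mono_onI)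
  fix x y assume x: "x \<in> {x. \<bar>x\<bar> \<in> V}" and y: "y \<in> {x. \<bar>x\<bar> \<in> V}" and xy: "x < y"
  have pos: "h \<bar>x\<bar> > 0" "h \<bar>y\<bar> > 0" using x y assms(2) by auto
  have less: "\<bar>x\<bar> < \<bar>y\<bar> \<Longrightarrow> h \<bar>x\<bar> < h \<bar>y\<bar>" "\<bar>y\<bar> < \<bar>x\<bar> \<Longrightarrow> h \<bar>y\<bar> < h \<bar>x\<bar>"
    using x y by (auto intro: strict_mono_onD[OF assms(1)])
  consider "x < 0" "y < 0" | "x < 0" "y \<ge> 0" | "x = 0" "y > 0" | "x > 0" "y > 0"
    using xy by linarith
  then show "sgn x * h \<bar>x\<bar> < sgn y * h \<bar>y\<bar>"
  proof cases
    case 2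
    have "0 \<le> sgn y * h \<bar>y\<bar>" using 2 pos by (simp add: sgn_if)
    with 2 pos show ?thesis by simp
  qed (use pos less xy in auto)
qed

text \<open>The class of multiples of \<open>k\<close>, where the sign of the first letter counts as
  the descent at position zero. Fixing the negated values is of no help here, so whole signed words
  are relabelled to signed permutations of size \<open>s\<close>. The offset \<open>0 +\<close>
  keeps the shape of the progression lemmas.\<close>

lemma sum_signed_words_des_neg:
  assumes "k \<ge> 1" "s \<ge> 1" "finite U" "U \<subseteq> {0<..}" "card U = s"
  defines "P \<equiv> (\<lambda>m. 0 + m * int k) ` {1..int s}"
  shows "(\<Sum>f\<in>signed_words P U. monom 1 (e * des_on k P f + of_bool (f (int k) < 0))) =
    (\<Sum>\<pi>\<in>signed_perms s. monom (1::int) (e * des_A s 1 \<pi> + of_bool (\<pi> 1 < 0)))"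
proof -
  obtain h where h: "bij_betw h {1..int s} U" "strict_mono_on {1..int s} h"
    using ex_strict_mono_bij_betw_card[OF assms(3)] assms(5) by auto
  have p: "bij_betw (\<lambda>m. 0 + m * int k) {1..int s} P"
    unfolding P_def by (rule bij_betw_progression[OF assms(1)])
  have pos: "{1..int s} \<subseteq> {0<..}" by auto
  have hpos: "h v > 0" if "v \<in> {1..int s}" for v
    using bij_betw_apply[OF h(1) that] assms(4) by auto
  have "(\<Sum>f\<in>signed_words P U. monom (1::int) (e * des_on k P f + of_bool (f (int k) < 0))) =
    (\<Sum>f\<in>signed_words {1..int s} {1..int s}. monom (1::int) (e * des_A s 1 f + of_bool (f 1 < 0)))"
    (is "_ = sum ?g _")
    unfolding sum_signed_words_relabel[OF p h(1) pos assms(4)]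
  proof (rule sum.cong[OF refl])
    fix f assume f: "f \<in> signed_words {1..int s} {1..int s}"
    let ?f = "\<lambda>i. if i \<in> P then sgn (f (inv_into {1..int s} (\<lambda>m. 0 + m * int k) i)) *
      h \<bar>f (inv_into {1..int s} (\<lambda>m. 0 + m * int k) i)\<bar> else 0"
    define F where "F = ?f"
    have val: "F (0 + m * int k) = sgn (f m) * h \<bar>f m\<bar>" if m: "m \<in> {1..int s}" for m
    proof -
      have "0 + m * int k \<in> P" unfolding P_def by (rule imageI[OF m])
      then show ?thesis using bij_betw_inv_into_left[OF p m] by (simp add: F_def)
    qed
    have "des_on k P F = des_A s 1 (\<lambda>m. F (0 + m * int k))"
      unfolding P_def by (rule des_on_progression[OF assms(1)])
    also have "\<dots> = des_A s 1 (\<lambda>m. sgn (f m) * h \<bar>f m\<bar>)"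
      by (rule des_A_cong) (simp, rule val)
    also have "\<dots> = des_A s 1 f"
      by (rule des_A_strict_mono[OF strict_mono_on_odd_extension[OF h(2) hpos]])
         (use signed_wordsD(3)[OF f] in simp_all)
    finally have 1: "des_on k P F = des_A s 1 f" .
    have "1 \<in> {1..int s}" using assms(2) by simp
    then have "F (int k) = sgn (f 1) * h \<bar>f 1\<bar>" "h \<bar>f 1\<bar> > 0"
      using val[of 1] hpos signed_wordsD(3)[OF f] by simp_all
    \<comment> \<open>Position \<open>k\<close> has index one in the progression, and the odd
      extension of a positive function keeps signs.\<close>
    then have 2: "F (int k) < 0 \<longleftrightarrow> f 1 < 0"
      by (simp only: mult_less_0_iff) auto
    show "monom 1 (e * des_on k P F + of_bool (F (int k) < 0)) = ?g f"
      unfolding 1 2 ..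
  qed
  also have "\<dots> = (\<Sum>\<pi>\<in>signed_perms s. ?g (\<lambda>i. if i \<in> {1..int s} then \<pi> i else 0))"
    by (rule sum_signed_perms[symmetric])
  also have "\<dots> = (\<Sum>\<pi>\<in>signed_perms s. ?g \<pi>)"
  proof (rule sum.cong[OF refl])
    fix \<pi>
    have "des_A s 1 (\<lambda>i. if i \<in> {1..int s} then \<pi> i else 0) = des_A s 1 \<pi>"
      by (rule des_A_cong) auto
    then show "?g (\<lambda>i. if i \<in> {1..int s} then \<pi> i else 0) = ?g \<pi>"
      using assms(2) by simp
  qed
  finally show ?thesis .
qed

lemma signed_perms_0: "\<pi> \<in> signed_perms n \<Longrightarrow> \<pi> 0 = 0"
  using signed_permsD(2)[of \<pi> n 0] by simp

text \<open>The only additional index is zero. It is in range because \<open>k \<le> n\<close>, and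
  it is a descent exactly when \<open>f (int k)\<close> is negative.\<close>

lemma des_B_eq:
  assumes "1 \<le> k" "k \<le> n" "f 0 = 0"
  shows "des_B n k f = des_A n k f + of_bool (f (int k) < 0)"
proof -
  define A where "A = {i. 1 \<le> i \<and> i \<le> int n - int k \<and> f i > f (i + int k)}"
  have "finite A" by (rule finite_subset[of _ "{1..int n}"]) (auto simp: A_def)
  moreover have "0 \<notin> A" by (simp add: A_def)
  moreover have "{i. 0 \<le> i \<and> i \<le> int n - int k \<and> f i > f (i + int k)} =
      (if f (int k) < 0 then insert 0 A else A)"
  proof (intro set_eqI)
    fix i :: int
    show "i \<in> {i. 0 \<le> i \<and> i \<le> int n - int k \<and> f i > f (i + int k)} \<longleftrightarrow>
      i \<in> (if f (int k) < 0 then insert 0 A else A)"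
      using assms by (cases "i = 0") (auto simp: A_def)
  qed
  ultimately show ?thesis
    by (simp add: des_B_def des_A_def flip: A_def)
qed

subsection \<open>Residue classes of positions\<close>

definition residue_class :: "nat \<Rightarrow> nat \<Rightarrow> nat \<Rightarrow> int set" where
  "residue_class n k c = {i \<in> {1..int n}. i mod int k = int c}"

lemma card_eq_sum_fibers:
  assumes "finite X" "finite T" "key ` X \<subseteq> T"
  shows "card X = (\<Sum>c\<in>T. card {x\<in>X. key x = c})"
  using sum.group[OF assms, of "\<lambda>_. 1 :: nat"] by simp

lemma finite_residue_class: "finite (residue_class n k c)"
  by (rule finite_subset[of _ "{1..int n}"]) (auto simp: residue_class_def)

lemma UN_residue_class:
  assumes "k \<ge> 1"
  shows "(\<Union>c<k. residue_class n k c) = {1..int n}"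
proof -
  have "i \<in> (\<Union>c<k. residue_class n k c)" if "i \<in> {1..int n}" for i
    using that assms
    by (intro UN_I[where a = "nat (i mod int k)"]) (auto simp: residue_class_def nat_less_iff)
  then show ?thesis by (auto simp: residue_class_def)
qed

lemma disjoint_residue_class: "disjoint_family_on (residue_class n k) {..<k}"
  by (auto simp: disjoint_family_on_def residue_class_def)

lemma residue_class_0:
  assumes "k \<ge> 1" "n = d * k + r" "r < k"
  shows "residue_class n k 0 = (\<lambda>m. 0 + m * int k) ` {1..int d}"
proof (intro equalityI subsetI)
  fix i assume "i \<in> residue_class n k 0"
  then have i: "1 \<le> i" "i \<le> int n" "i mod int k = 0" by (auto simp: residue_class_def)
  then obtain m where m: "i = int k * m" by (auto simp: mod_eq_0_iff_dvd)
  \<comment> \<open>From \<open>i \<le> n = d * k + r\<close> and \<open>r < k\<close>.\<close>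
  have "int k * m < int k * (int d + 1)"
    using i(2) assms(2,3) unfolding m by (simp add: algebra_simps)
  then have "m \<le> int d" using assms(1) by simp
  moreover have "m \<ge> 1"
    using i(1) assms(1) unfolding m by (smt (verit) mult_nonneg_nonpos of_nat_0_le_iff)
  ultimately show "i \<in> (\<lambda>m. 0 + m * int k) ` {1..int d}" by (auto simp: m mult.commute)
next
  fix i assume "i \<in> (\<lambda>m. 0 + m * int k) ` {1..int d}"
  then obtain m where "i = 0 + m * int k" "m \<in> {1..int d}" by (rule imageE)
  then have m: "i = m * int k" "1 \<le> m" "m \<le> int d" by simp_all
  have "1 * 1 \<le> m * int k" using m assms(1) by (intro mult_mono) auto
  moreover have "m * int k \<le> int d * int k" using m by (intro mult_right_mono) auto
  moreover have "int d * int k \<le> int n" using assms(2) by simp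
  ultimately show "i \<in> residue_class n k 0"
    using m by (simp add: residue_class_def)
qed

text \<open>The offset \<open>int c - int k\<close> makes the index start at one, so
  \<open>m = 1\<close> is position \<open>c\<close>. Position \<open>c + d * k\<close> still fits
  below \<open>n\<close> exactly when \<open>c \<le> r\<close>, which decides the length.\<close>

lemma residue_class_pos:
  assumes "n = d * k + r" "r < k" "1 \<le> c" "c < k"
  shows "residue_class n k c =
    (\<lambda>m. (int c - int k) + m * int k) ` {1..int (if c \<le> r then d + 1 else d)}"
proof (intro equalityI subsetI)
  fix i assume "i \<in> residue_class n k c"
  then have i: "1 \<le> i" "i \<le> int n" "i mod int k = int c" by (auto simp: residue_class_def)
  define m where "m = i div int k"
  have im: "i = int c + m * int k"
    using i(3) div_mult_mod_eq[of i "int k"] by (simp add: m_def)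
  have "m \<ge> 0" using i(1) assms by (auto simp: m_def pos_imp_zdiv_nonneg_iff)
  moreover have "m < int (if c \<le> r then d + 1 else d)"
  proof (cases "c \<le> r")
    case True
    have "m * int k < (int d + 1) * int k"
      using i(2) assms unfolding im by (simp add: algebra_simps)
    then have "m < int d + 1" using assms by simp
    with True show ?thesis by simp
  next
    case False
    have "int c + m * int k \<le> int d * int k + int r"
      using i(2) assms(1) by (simp add: im)
    then have "m * int k < int d * int k" using False by linarith
    then have "m < int d" using assms by simp
    with False show ?thesis by simp
  qed
  ultimately show "i \<in> (\<lambda>m. (int c - int k) + m * int k) ` {1..int (if c \<le> r then d + 1 else d)}"
    \<comment> \<open>The quotient \<open>m\<close> starts at zero, the index of the progression at
      one.\<close>
    by (intro image_eqI[where x = "m + 1"]) (simp_all add: im algebra_simps)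
next
  fix i assume "i \<in> (\<lambda>m. (int c - int k) + m * int k) ` {1..int (if c \<le> r then d + 1 else d)}"
  then obtain m where "i = int c - int k + m * int k" "m \<in> {1..int (if c \<le> r then d + 1 else d)}"
    by (rule imageE)
  then have m: "i = int c + (m - 1) * int k" "1 \<le> m" "m \<le> int (if c \<le> r then d + 1 else d)"
    by (simp_all add: left_diff_distrib)
  have n: "int n = int d * int k + int r" using assms(1) by simp
  have "0 \<le> (m - 1) * int k" using m by simp
  then have "1 \<le> int c + (m - 1) * int k" using assms(3) by linarith
  moreover have "int c + (m - 1) * int k \<le> int n"
  proof (cases "c \<le> r")
    case True
    then have "(m - 1) * int k \<le> int d * int k" using m by (intro mult_right_mono) auto
    then show ?thesis using n True by linarith
  next
    case False
    then have "(m - 1) * int k \<le> (int d - 1) * int k" using m by (intro mult_right_mono) auto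
    also have "(int d - 1) * int k = int d * int k - int k" by (simp add: left_diff_distrib)
    finally show ?thesis using n assms(4) by linarith
  qed
  ultimately show "i \<in> residue_class n k c"
    using m assms by (simp add: residue_class_def)
qed

lemma card_progression:
  assumes "k \<ge> 1"
  shows "card ((\<lambda>m. a + m * int k) ` {1..int s}) = s"
  using bij_betw_same_card[OF bij_betw_progression[OF assms, of a "{1..int s}"]] by simp

lemma card_residue_class:
  assumes "n = d * k + r" "r < k" "c < k"
  shows "card (residue_class n k c) = (if 1 \<le> c \<and> c \<le> r then d + 1 else d)"
proof (cases "c = 0")
  case True
  then show ?thesis using assms by (simp add: residue_class_0 card_progression[where a = 0, simplified])
next
  case False
  then show ?thesis using assms by (simp only: residue_class_pos card_progression) simp
qed

section \<open>Splitting the statistics over the residue classes\<close>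

lemma nat_mod_eq_iff:
  assumes "k \<ge> 1"
  shows "nat (i mod int k) = c \<longleftrightarrow> i mod int k = int c"
  using assms by (auto simp: nat_eq_iff)

text \<open>\<open>i\<close> and \<open>i + k\<close> have the same residue, and
  \<open>i \<le> n - k\<close> says precisely that the second one is still a position.\<close>

lemma des_A_eq_sum:
  assumes "k \<ge> 1"
  shows "des_A n k f = (\<Sum>c<k. des_on k (residue_class n k c) f)"
proof -
  let ?X = "{i. 1 \<le> i \<and> i \<le> int n - int k \<and> f i > f (i + int k)}"
  have "finite ?X" by (rule finite_subset[of _ "{1..int n}"]) auto
  then have "des_A n k f = (\<Sum>c<k. card {i\<in>?X. nat (i mod int k) = c})"
    unfolding des_A_def using assms
    by (intro card_eq_sum_fibers) (auto simp: nat_less_iff)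
  also have "\<dots> = (\<Sum>c<k. des_on k (residue_class n k c) f)"
    unfolding des_on_def nat_mod_eq_iff[OF assms] residue_class_def
    by (intro sum.cong refl arg_cong[where f = card]) auto
  finally show ?thesis .
qed

lemma mod_eq_iff_positive_multiple:
  fixes i j :: int
  assumes "k \<ge> 1" "i < j"
  shows "i mod int k = j mod int k \<longleftrightarrow> (\<exists>m>0. j - i = m * int k)"
proof
  assume "i mod int k = j mod int k"
  then have "int k dvd j - i" by (metis mod_eq_dvd_iff)
  then obtain m where "j - i = int k * m" ..
  then have m: "j - i = m * int k" by (simp only: mult.commute)
  moreover have "m > 0"
    using m assms by (smt (verit) mult_nonpos_nonneg of_nat_0_le_iff)
  ultimately show "\<exists>m>0. j - i = m * int k" by auto
next
  assume "\<exists>m>0. j - i = m * int k"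
  then have "int k dvd j - i" by auto
  then show "i mod int k = j mod int k" by (metis mod_eq_dvd_iff)
qed

text \<open>For \<open>i < j\<close> the multiple condition is congruence modulo \<open>k\<close>,
  so each pair lies within one class. The relation \<open>R\<close> is left open to cover both
  inversions and negative sums.\<close>

lemma card_pairs_eq_sum:
  assumes "k \<ge> 1"
  shows "card {(i, j). 1 \<le> i \<and> i < j \<and> j \<le> int n \<and> R i j \<and> (\<exists>m>0. j - i = m * int k)} =
    (\<Sum>c<k. card {(i, j). i \<in> residue_class n k c \<and> j \<in> residue_class n k c \<and> i < j \<and> R i j})"
proof -
  let ?X = "{(i, j). 1 \<le> i \<and> i < j \<and> j \<le> int n \<and> R i j \<and> (\<exists>m>0. j - i = m * int k)}"
  have "finite ?X" by (rule finite_subset[of _ "{1..int n} \<times> {1..int n}"]) auto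
  then have "card ?X = (\<Sum>c<k. card {x\<in>?X. nat (fst x mod int k) = c})"
    using assms by (intro card_eq_sum_fibers) (auto simp: nat_less_iff)
  also have "\<dots> = (\<Sum>c<k. card {(i, j). i \<in> residue_class n k c \<and> j \<in> residue_class n k c \<and> i < j \<and> R i j})"
  proof (intro sum.cong refl arg_cong[where f = card] set_eqI)
    fix c and x :: "int \<times> int"
    obtain i j where x: "x = (i, j)" by (cases x)
    show "x \<in> {x\<in>?X. nat (fst x mod int k) = c} \<longleftrightarrow>
      x \<in> {(i, j). i \<in> residue_class n k c \<and> j \<in> residue_class n k c \<and> i < j \<and> R i j}"
    proof (cases "i < j")
      case True
      show ?thesis
        unfolding x residue_class_def nat_mod_eq_iff[OF assms]
        using True by (auto simp flip: mod_eq_iff_positive_multiple[OF assms True])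
    qed (simp add: x)
  qed
  finally show ?thesis .
qed

lemma neg_eq:
  assumes "k \<ge> 1"
  shows "neg n k f = card {i \<in> residue_class n k 0. f i < 0}"
proof -
  have "n = (n div k) * k + n mod k" "n mod k < k" using assms by simp_all
  then have R: "residue_class n k 0 = (\<lambda>m. 0 + m * int k) ` {1..int (n div k)}"
    using assms by (intro residue_class_0)
  have "{i \<in> residue_class n k 0. f i < 0} =
      (\<lambda>m. m * int k) ` {i. 1 \<le> i \<and> i \<le> int (n div k) \<and> f (i * int k) < 0}"
    unfolding R by auto
  moreover have "inj_on (\<lambda>m. m * int k) A" for A
    using assms by (auto simp: inj_on_def)
  ultimately show ?thesis by (simp add: neg_def card_image)
qed

text \<open>\<open>neg\<close> reads only multiples of \<open>k\<close>, so it joins class zero: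
  there the weight of the negative letters is one (type B), elsewhere zero (type D).\<close>

lemma inv_B_eq_sum:
  assumes "k \<ge> 1"
  shows "inv_B n k f = (\<Sum>c<k. signed_inv (of_bool (c = 0)) (residue_class n k c) f)"
proof -
  \<comment> \<open>The definition of \<open>nsp\<close> does not require \<open>i < j\<close>, but
    a positive multiple of \<open>k\<close> as difference forces it.\<close>
  have "nsp n k f =
    card {(i, j). 1 \<le> i \<and> i < j \<and> j \<le> int n \<and> f i + f j < 0 \<and> (\<exists>m>0. j - i = m * int k)}"
  proof -
    have "i < j" if "\<exists>m>0. j - i = m * int k" for i j
    proof -
      from that obtain m where "m > 0" "j - i = m * int k" by auto
      moreover have "m * int k > 0" using \<open>m > 0\<close> assms by simp
      ultimately show ?thesis by linarith
    qed
    then show ?thesis unfolding nsp_def by (intro arg_cong[where f = card]) auto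
  qed
  then have nsp: "nsp n k f = (\<Sum>c<k. card {(i, j). i \<in> residue_class n k c \<and>
      j \<in> residue_class n k c \<and> i < j \<and> f i + f j < 0})"
    by (simp only: card_pairs_eq_sum[OF assms])
  have inv: "inv_A n k f = (\<Sum>c<k. card {(i, j). i \<in> residue_class n k c \<and>
      j \<in> residue_class n k c \<and> i < j \<and> f i > f j})"
    unfolding inv_A_def by (rule card_pairs_eq_sum[OF assms])
  have "(\<Sum>c<k. of_bool (c = 0) * card {i \<in> residue_class n k c. f i < 0}) = neg n k f"
    using assms by (simp add: neg_eq of_bool_def if_distrib[where f = "\<lambda>x. x * _"] sum.delta cong: if_cong)
  then show ?thesis
    by (simp add: inv_B_def signed_inv_def sum.distrib nsp inv)
qed

section \<open>Assembling the class factors\<close>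

lemma monom_sum_eq_prod: "monom (1::int) (\<Sum>c\<in>I. e c) = (\<Prod>c\<in>I. monom 1 (e c))"
proof (induction I rule: infinite_finite_induct)
  case (insert x F)
  then show ?case
    using mult_monom[of "1::int" "e x" 1 "\<Sum>c\<in>F. e c"] by simp
qed simp_all

lemma prod_residues:
  fixes a :: "'a::comm_monoid_mult"
  assumes "r < k"
  shows "(\<Prod>c<k. if c = 0 then a else if c \<le> r then b else z) = a * b ^ r * z ^ (k - r - 1)"
proof -
  have "{..<k} = insert 0 ({1..r} \<union> {r+1..<k})" using assms by auto
  moreover have "(\<Prod>c\<in>{1..r} \<union> {r+1..<k}. if c = 0 then a else if c \<le> r then b else z) =
      (\<Prod>c\<in>{1..r}. b) * (\<Prod>c\<in>{r+1..<k}. z)"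
    by (subst prod.union_disjoint) (auto intro!: arg_cong2[where f = "(*)"] prod.cong)
  ultimately show ?thesis by (simp add: mult_ac)
qed

text \<open>\<open>sum_signed_words_prod\<close> for the residue classes. The product
  \<open>D\<close> of the factorials of their sizes is the denominator of \<open>multinom\<close>,
  and it cancels because integer polynomials have no zero divisors and \<open>D\<close> is nonzero
  there.\<close>

lemma sum_signed_perms_prod:
  fixes T :: "nat \<Rightarrow> int poly"
  assumes "k \<ge> 1" "n = d * k + r" "r < k"
    and local: "\<And>c f h. c < k \<Longrightarrow> (\<And>i. i \<in> residue_class n k c \<Longrightarrow> f i = h i) \<Longrightarrow> g c f = g c h"
    and T: "\<And>c U. c < k \<Longrightarrow> finite U \<Longrightarrow> U \<subseteq> {0<..} \<Longrightarrow> card U = card (residue_class n k c) \<Longrightarrow>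
              (\<Sum>f\<in>signed_words (residue_class n k c) U. g c f) = T c"
  shows "(\<Sum>\<pi>\<in>signed_perms n. \<Prod>c<k. g c \<pi>) = of_nat (multinom n k) * (\<Prod>c<k. T c)"
proof -
  have div: "n div k = d" "n mod k = r" using assms(1-3) by simp_all
  define D :: nat where "D = (\<Prod>c<k. fact (card (residue_class n k c)))"
  have "D = (\<Prod>c<k. if c = 0 then fact d else if c \<le> r then fact (d + 1) else fact d)"
    unfolding D_def using assms(2,3) by (intro prod.cong refl) (auto simp: card_residue_class)
  also have "\<dots> = fact (d + 1) ^ r * (fact d * fact d ^ (k - r - 1))"
    unfolding prod_residues[OF assms(3)] by (simp only: mult_ac)
  also have "fact d * fact d ^ (k - r - 1) = (fact d ^ (k - r) :: nat)"
    using assms(3) by (simp add: Suc_diff_Suc flip: power_Suc)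
  finally have "D * multinom n k = fact n"
    using multinom_denominator_dvd[OF assms(1), of n] by (simp add: multinom_def div)
  then have Dm: "fact n = (of_nat D * of_nat (multinom n k) :: int poly)"
    by (metis of_nat_mult of_nat_fact)
  have "D \<noteq> 0" by (simp add: D_def)
  \<comment> \<open>Each \<open>g c\<close> sees only positive positions, so \<open>\<pi>\<close>
    may be cut down to a word.\<close>
  have "(\<Sum>\<pi>\<in>signed_perms n. \<Prod>c<k. g c \<pi>) =
      (\<Sum>\<pi>\<in>signed_perms n. \<Prod>c<k. g c (\<lambda>i. if i \<in> {1..int n} then \<pi> i else 0))"
    by (intro sum.cong prod.cong refl local) (auto simp: residue_class_def)
  also have "\<dots> = (\<Sum>f\<in>signed_words {1..int n} {1..int n}. \<Prod>c<k. g c f)"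
    by (rule sum_signed_perms)
  finally have sum: "(\<Sum>\<pi>\<in>signed_perms n. \<Prod>c<k. g c \<pi>) = \<dots>" .
  have "of_nat (\<Prod>c<k. fact (card (residue_class n k c))) *
      (\<Sum>f\<in>signed_words (\<Union>c<k. residue_class n k c) {1..int n}. \<Prod>c<k. g c f) =
      of_nat (fact (card {1..int n})) * (\<Prod>c<k. T c)"
  proof (rule sum_signed_words_prod)
    show "finite (residue_class n k c)" for c by (rule finite_residue_class)
    show "card {1..int n} = card (\<Union>c<k. residue_class n k c)"
      by (simp only: UN_residue_class[OF assms(1)])
    show "g c f = g c h" if "c \<in> {..<k}" "\<And>i. i \<in> residue_class n k c \<Longrightarrow> f i = h i" for c f h
      using that by (intro local) simp_all
    show "(\<Sum>f\<in>signed_words (residue_class n k c) U. g c f) = T c"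
      if "c \<in> {..<k}" "finite U" "U \<subseteq> {0<..}" "card U = card (residue_class n k c)" for c U
      using that by (intro T) simp_all
  qed (auto simp: disjoint_residue_class)
  then have "of_nat D * (\<Sum>\<pi>\<in>signed_perms n. \<Prod>c<k. g c \<pi>) =
      of_nat D * (of_nat (multinom n k) * (\<Prod>c<k. T c))"
    unfolding UN_residue_class[OF assms(1)] by (simp add: sum Dm mult.assoc flip: D_def)
  then show ?thesis using \<open>D \<noteq> 0\<close> by simp
qed

text \<open>With \<open>e = 1\<close> this is the statement for \<open>des_B\<close>, with
  \<open>e = 2\<close> that for \<open>fdes_B\<close>, where every descent at a positive position
  counts twice and the one at zero once.\<close>

lemma sum_signed_perms_des:
  assumes "1 \<le> k" "k \<le> n" "n = d * k + r" "r < k"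
  shows "(\<Sum>\<pi>\<in>signed_perms n. monom (1::int) (e * des_A n k \<pi> + of_bool (\<pi> (int k) < 0))) =
    2 ^ (n - d) * of_nat (multinom n k) *
    (\<Sum>\<pi>\<in>signed_perms d. monom 1 (e * des_A d 1 \<pi> + of_bool (\<pi> 1 < 0))) *
    pcompose (eulerian_A d) (monom 1 e) ^ (k - r - 1) *
    pcompose (eulerian_A (d + 1)) (monom 1 e) ^ r"
proof -
  \<comment> \<open>The term for the descent at zero is charged to class zero, the class that
    contains position \<open>k\<close>.\<close>
  define stat where "stat = (\<lambda>c f. e * des_on k (residue_class n k c) f +
    of_bool (c = 0) * of_bool (f (int k) < (0::int)))"
  define F :: "int poly" where
    "F = (\<Sum>\<pi>\<in>signed_perms d. monom 1 (e * des_A d 1 \<pi> + of_bool (\<pi> 1 < 0)))"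
  define A :: "nat \<Rightarrow> int poly" where "A = (\<lambda>s. 2 ^ s * pcompose (eulerian_A s) (monom 1 e))"
  have d: "d \<ge> 1" using assms by (cases d) auto
  have k0: "int k \<in> residue_class n k 0" using assms(1,2) by (simp add: residue_class_def)
  have "(\<Sum>\<pi>\<in>signed_perms n. monom (1::int) (e * des_A n k \<pi> + of_bool (\<pi> (int k) < 0))) =
    (\<Sum>\<pi>\<in>signed_perms n. \<Prod>c<k. monom 1 (stat c \<pi>))"
  proof (rule sum.cong[OF refl])
    fix \<pi> :: "int \<Rightarrow> int"
    have "(\<Sum>c<k. of_bool (c = 0) * of_bool (\<pi> (int k) < 0)) = (of_bool (\<pi> (int k) < 0) :: nat)"
      using assms(1) by (simp add: of_bool_def if_distrib[where f = "\<lambda>x. x * _"] sum.delta cong: if_cong)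
    then have "e * des_A n k \<pi> + of_bool (\<pi> (int k) < 0) = (\<Sum>c<k. stat c \<pi>)"
      by (simp only: stat_def sum.distrib des_A_eq_sum[OF assms(1)] flip: sum_distrib_left)
    then show "monom 1 (e * des_A n k \<pi> + of_bool (\<pi> (int k) < 0)) = (\<Prod>c<k. monom (1::int) (stat c \<pi>))"
      by (simp only: monom_sum_eq_prod)
  qed
  also have "\<dots> = of_nat (multinom n k) *
      (\<Prod>c<k. if c = 0 then F else if c \<le> r then A (d + 1) else A d)"
  proof (rule sum_signed_perms_prod[OF assms(1,3,4)])
    fix c and f h :: "int \<Rightarrow> int"
    assume eq: "\<And>i. i \<in> residue_class n k c \<Longrightarrow> f i = h i"
    show "monom 1 (stat c f) = monom 1 (stat c h)"
    proof (cases "c = 0")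
      case True
      then show ?thesis
        using des_on_cong[of "residue_class n k c" f h k, OF eq] eq k0 by (simp add: stat_def)
    qed (use des_on_cong[of "residue_class n k c" f h k, OF eq] in \<open>simp add: stat_def\<close>)
  next
    fix c and U :: "int set"
    assume c: "c < k" and U: "finite U" "U \<subseteq> {0<..}" "card U = card (residue_class n k c)"
    show "(\<Sum>f\<in>signed_words (residue_class n k c) U. monom 1 (stat c f)) =
      (if c = 0 then F else if c \<le> r then A (d + 1) else A d)"
    proof (cases "c = 0")
      case True
      have "card U = d" using U(3) card_residue_class[OF assms(3,4) c] True by simp
      from sum_signed_words_des_neg[OF assms(1) d U(1,2) this, of e] show ?thesis
        unfolding True stat_def F_def residue_class_0[OF assms(1,3,4)] by simp
    next
      case False
      define s where "s = (if c \<le> r then d + 1 else d)"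
      have c1: "c \<ge> 1" using False by simp
      have "card U = s" using U(3) card_residue_class[OF assms(3,4) c] False by (simp add: s_def)
      from sum_signed_words_des[OF assms(1) U(1,2) this, of e "int c - int k"]
      have "(\<Sum>f\<in>signed_words (residue_class n k c) U. monom 1 (e * des_on k (residue_class n k c) f)) = A s"
        unfolding residue_class_pos[OF assms(3,4) c1 c] A_def s_def .
      then show ?thesis using False by (simp add: stat_def s_def)
    qed
  qed
  also have "\<dots> = of_nat (multinom n k) * (F * A (d + 1) ^ r * A d ^ (k - r - 1))"
    by (simp only: prod_residues[OF assms(4)])
  \<comment> \<open>The exponent of two counts the positions outside class zero: \<open>r\<close>
    classes of size \<open>d + 1\<close> and \<open>k - r - 1\<close> of size
    \<open>d\<close>.\<close>
  also have "n - d = (d + 1) * r + d * (k - r - 1)"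
  proof -
    obtain t where "k = r + 1 + t" using assms(4) by (metis Suc_eq_plus1 Suc_leI le_Suc_ex)
    then show ?thesis using assms(3) by (simp add: algebra_simps)
  qed
  ultimately show ?thesis
    by (simp add: F_def A_def power_mult_distrib power_add power_mult mult_ac)
qed

lemma sum_signed_perms_inv:
  assumes "1 \<le> k" "k \<le> n" "n = d * k + r" "r < k"
  shows "(\<Sum>\<pi>\<in>signed_perms n. monom (1::int) (inv_B n k \<pi>)) =
    2 ^ (k - 1) * of_nat (multinom n k) *
    q_num d ^ (k - r - 1) * q_num (d + 1) ^ r *
    q_even_dfact d ^ (r + 1) * q_even_dfact (d - 1) ^ (k - r - 1)"
proof -
  define A where "A = (\<lambda>s. 2 * q_num s * q_even_dfact (s - 1))"
  \<comment> \<open>Needed for the type D closed form on the classes of size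
    \<open>d\<close>.\<close>
  have d: "d \<ge> 1" using assms by (cases d) auto
  have "(\<Sum>\<pi>\<in>signed_perms n. monom (1::int) (inv_B n k \<pi>)) =
    (\<Sum>\<pi>\<in>signed_perms n. \<Prod>c<k. monom 1 (signed_inv (of_bool (c = 0)) (residue_class n k c) \<pi>))"
    by (simp only: inv_B_eq_sum[OF assms(1)] monom_sum_eq_prod)
  also have "\<dots> = of_nat (multinom n k) *
      (\<Prod>c<k. if c = 0 then q_even_dfact d else if c \<le> r then A (d + 1) else A d)"
  proof (rule sum_signed_perms_prod[OF assms(1,3,4)])
    fix c and f h :: "int \<Rightarrow> int"
    assume eq: "\<And>i. i \<in> residue_class n k c \<Longrightarrow> f i = h i"
    show "monom 1 (signed_inv (of_bool (c = 0)) (residue_class n k c) f) =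
      monom 1 (signed_inv (of_bool (c = 0)) (residue_class n k c) h)"
      by (intro arg_cong[where f = "monom 1"] signed_inv_cong eq)
  next
    fix c and U :: "int set"
    assume c: "c < k" and U: "finite U" "U \<subseteq> {0<..}" "card U = card (residue_class n k c)"
    have sum: "(\<Sum>f\<in>signed_words (residue_class n k c) U.
        monom 1 (signed_inv (of_bool (c = 0)) (residue_class n k c) f)) =
      (\<Prod>s=1..if 1 \<le> c \<and> c \<le> r then d + 1 else d. q_num s * (1 + monom 1 (s - 1 + of_bool (c = 0))))"
      using sum_signed_words_inv[OF finite_residue_class U] by (simp only: card_residue_class[OF assms(3,4) c])
    show "(\<Sum>f\<in>signed_words (residue_class n k c) U.
        monom 1 (signed_inv (of_bool (c = 0)) (residue_class n k c) f)) =
      (if c = 0 then q_even_dfact d else if c \<le> r then A (d + 1) else A d)"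
    proof (cases "c = 0")
      case True
      then show ?thesis unfolding sum using prod_q_num_type_B[of d] by simp
    next
      case False
      then show ?thesis unfolding sum A_def
        using prod_q_num_type_D[of "d + 1"] prod_q_num_type_D[OF d] by simp
    qed
  qed
  also have "\<dots> = of_nat (multinom n k) * (q_even_dfact d * A (d + 1) ^ r * A d ^ (k - r - 1))"
    by (simp only: prod_residues[OF assms(4)])
  \<comment> \<open>Each of the \<open>k - 1\<close> nonzero classes gives a factor two.
    \<open>q_even_dfact d\<close> comes once from class zero and once from each of the
    \<open>r\<close> longer classes.\<close>
  also have "k - 1 = r + (k - r - 1)" using assms(4) by simp
  ultimately show ?thesis
    by (simp add: A_def power_mult_distrib power_add mult_ac)
qed

theorem theorem15:
  fixes n k d r :: nat
  assumes "1 \<le> k" and "k \<le> n" and "n = d * k + r" and "r < k"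
  shows "(\<Sum>\<pi>\<in>signed_perms n. monom (1::int) (des_B n k \<pi>)) =
           2 ^ (n - d) * of_nat (multinom n k) * eulerian_B d *
           eulerian_A d ^ (k - r - 1) * eulerian_A (d + 1) ^ r \<and>
         (\<Sum>\<pi>\<in>signed_perms n. monom (1::int) (fdes_B n k \<pi>)) =
           2 ^ (n - d) * of_nat (multinom n k) * flag_eulerian_B d *
           pcompose (eulerian_A d) (monom 1 2) ^ (k - r - 1) *
           pcompose (eulerian_A (d + 1)) (monom 1 2) ^ r \<and>
         (\<Sum>\<pi>\<in>signed_perms n. monom (1::int) (inv_B n k \<pi>)) =
           2 ^ (k - 1) * of_nat (multinom n k) *
           q_num d ^ (k - r - 1) * q_num (d + 1) ^ r *
           q_even_dfact d ^ (r + 1) * q_even_dfact (d - 1) ^ (k - r - 1)"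
proof (intro conjI)
  have d: "1 \<le> d" using assms by (cases d) auto
  \<comment> \<open>Stated for general sizes: used for \<open>n\<close> and \<open>k\<close> on the
    left side, and for \<open>d\<close> and \<open>1\<close> to rewrite the type B polynomial. The
    literal \<open>1 *\<close> matches \<open>sum_signed_perms_des\<close> at
    \<open>e = 1\<close>.\<close>
  have des: "des_B m l \<pi> = 1 * des_A m l \<pi> + of_bool (\<pi> (int l) < 0)"
    and fdes: "fdes_B m l \<pi> = 2 * des_A m l \<pi> + of_bool (\<pi> (int l) < 0)"
    if "\<pi> \<in> signed_perms m" "1 \<le> l" "l \<le> m" for \<pi> m l
    using des_B_eq[of l m \<pi>] signed_perms_0[OF that(1)] that by (simp_all add: fdes_B_def)
  \<comment> \<open>At \<open>e = 1\<close> the substitution replaces \<open>x\<close> by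
    itself.\<close>
  have id: "pcompose p (monom 1 1) = p" for p :: "int poly"
    by (simp add: monom_Suc monom_0)
  have "(\<Sum>\<pi>\<in>signed_perms n. monom (1::int) (des_B n k \<pi>)) =
      (\<Sum>\<pi>\<in>signed_perms n. monom 1 (1 * des_A n k \<pi> + of_bool (\<pi> (int k) < 0)))"
    using assms by (intro sum.cong refl) (simp only: des)
  moreover have "eulerian_B d =
      (\<Sum>\<pi>\<in>signed_perms d. monom 1 (1 * des_A d 1 \<pi> + of_bool (\<pi> 1 < 0)))"
    unfolding eulerian_B_def using des[OF _ _ d] by (intro sum.cong refl) simp
  ultimately show "(\<Sum>\<pi>\<in>signed_perms n. monom (1::int) (des_B n k \<pi>)) =
      2 ^ (n - d) * of_nat (multinom n k) * eulerian_B d *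
      eulerian_A d ^ (k - r - 1) * eulerian_A (d + 1) ^ r"
    by (simp only: sum_signed_perms_des[OF assms] id)
  have "(\<Sum>\<pi>\<in>signed_perms n. monom (1::int) (fdes_B n k \<pi>)) =
      (\<Sum>\<pi>\<in>signed_perms n. monom 1 (2 * des_A n k \<pi> + of_bool (\<pi> (int k) < 0)))"
    using assms by (intro sum.cong refl) (simp only: fdes)
  moreover have "flag_eulerian_B d =
      (\<Sum>\<pi>\<in>signed_perms d. monom 1 (2 * des_A d 1 \<pi> + of_bool (\<pi> 1 < 0)))"
    unfolding flag_eulerian_B_def using fdes[OF _ _ d] by (intro sum.cong refl) simp
  ultimately show "(\<Sum>\<pi>\<in>signed_perms n. monom (1::int) (fdes_B n k \<pi>)) =
      2 ^ (n - d) * of_nat (multinom n k) * flag_eulerian_B d *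
      pcompose (eulerian_A d) (monom 1 2) ^ (k - r - 1) *
      pcompose (eulerian_A (d + 1)) (monom 1 2) ^ r"
    by (simp only: sum_signed_perms_des[OF assms])
qed (rule sum_signed_perms_inv[OF assms])

end
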